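(* Let $n\ge 1$ and let $X_1,\dots,X_n,Y$ be jointly distributed random variables with finite state sets and arbitrary joint distribution $p$. For $A\subseteq[n]=\{1,\dots,n\}$ let $I_A(X_1,\dots,X_n;Y)$ be the information contribution of the set of input variables $\{X_i : i\in A\}$, as defined in the context. Then, for every $A\subseteq [n]$: (I) (nonnegativity) $I_A(X_1,\dots,X_n;Y)\ge 0$. (II) (completeness) $\sum_{B\subseteq[n]} I_B(X_1,\dots,X_n;Y)=I(X_1,\dots,X_n;Y)$, where the right-hand side is the mutual information between $(X_1,\dots,X_n)$ and $Y$. (III) (symmetry) The contribution is invariant under permutations of $X_1,\dots,X_n$: for every permutation $\tau$ of $[n]$, $I_{\tau^{-1}(A)}(X_{\tau(1)},\dots,X_{\tau(n)};Y)=I_A(X_1,\dots,X_n;Y)$ (both sides refer to the same set of variables $\{X_i: i\in A\}$). (IV) (singleton) If $Y=(X_1,\dots,X_n)$, that is, $Y$ is an identical copy of the tuple of inputs, and $|A|>1$, then $I_A(X_1,\dots,X_n;(X_1,\dots,X_n))=0$. (V) (additivity) If $X_i=(X_i',X_i'')$ for all $i$, $Y=(Y',Y'')$, and $$p(x_1,\dots,x_n,y)=p(x_1',\dots,x_n',y')\,p(x_1'',\dots,x_n'',y'')$$ for all values $x_i=(x_i',x_i'')$, $y=(y',y'')$, then $$I_A(X_1,\dots,X_n;Y)=I_{A}(X_1',\dots,X_n';Y')+I_{A}(X_1'',\dots,X_n'';Y''),$$ where on the right-hand side $A$ stands for the sets of variables $\{X_i': i\in A\}$ and $\{X_i'': i\in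 A\}$, respectively.
   Context: Sets of input variables are identified with index sets $A\subseteq[n]$. $D_{\mathrm{KL}}(q\|r)=\sum_z q(z)\log\frac{q(z)}{r(z)}$ is the Kullback-Leibler divergence and $H$ is Shannon entropy, all logarithms having the same fixed base. Simplicial complexes: here a simplicial complex over $[n]$ is a non-empty set $\mathfrak S$ of subsets of $[n]$ such that $A\in\mathfrak S$ and $B\subseteq A$ imply $B\in\mathfrak S$ (so $\emptyset\in\mathfrak S$; $\mathfrak S$ need not cover $[n]$). The input lattice is the set of all simplicial complexes over $[n]$ ordered by inclusion (equivalently, $\mathfrak S\le\mathfrak S'$ iff every $A\in\mathfrak S$ is contained in some $B\in\mathfrak S'$). Its bottom element is $\{\emptyset\}$ and its top element is $2^{[n]}$. Split distributions: for a simplicial complex $\mathfrak S$ over $[n]$, let $M_{\mathfrak S}$ be the set of all joint probability distributions $q$ on the joint state space of $(X_1,\dots,X_n,Y)$ such that the marginal of $q$ on $(X_1,\dots,X_n)$ equals that of $p$ and, for every $A\in\mathfrak S$, the marginal of $q$ on $((X_i)_{i\in A},Y)$ equals that of $p$ (for $A=\emptyset$: the marginal on $Y$). The split distribution is $p_{\mathfrak S}=\operatorname{argmax}_{q\in M_{\mathfrak S}}H(q)$, the unique maximum entropy element of $M_{\mathfrak S}$. Maximal chains: $\Gamma$ is the set of all maximal chains of the input lattice from $\{\emptyset\}$ to $2^{[n]}$; consecutive elements of such a chain differ by the addition of exactly one subset of $[n]$. For $A\subseteq[n]$, $\mathcal E_A$ is the set of pairs $(\mathfrak S,\mathfrak S')$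 of simplicial complexes over $[n]$ with $A\notin\mathfrak S$ and $\mathfrak S'=\mathfrak S\cup\{A\}$ (so $\mathcal E_\emptyset$ is empty). $n_{(\mathfrak S,\mathfrak S')}$ is the number of chains in $\Gamma$ in which $\mathfrak S$ and $\mathfrak S'$ are consecutive elements. Information contribution: $$I_A(X_1,\dots,X_n;Y)=\frac1{|\Gamma|}\sum_{(\mathfrak S,\mathfrak S')\in\mathcal E_A} n_{(\mathfrak S,\mathfrak S')}\,D_{\mathrm{KL}}(p_{\mathfrak S'}\|p_{\mathfrak S}),$$ an empty sum being $0$ (so $I_\emptyset=0$). *)

theory Defs
  imports "HOL-Probability.Probability"
begin

text \<open>
  The inputs \<open>X 1, \<dots>, X n\<close> and the output \<open>Y\<close> are random variables on a probability space
  \<open>M\<close>.  The state set \<open>S i\<close> of \<open>X i\<close> may depend on \<open>i\<close>; only the ambient type of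
  values is shared.
\<close>

definition finite_rvs ::
  "nat \<Rightarrow> 'w measure \<Rightarrow> (nat \<Rightarrow> 'a set) \<Rightarrow> 'y set \<Rightarrow> (nat \<Rightarrow> 'w \<Rightarrow> 'a) \<Rightarrow> ('w \<Rightarrow> 'y) \<Rightarrow> bool" where
  "finite_rvs n M S T X Y \<longleftrightarrow>
     prob_space M \<and>
     (\<forall>i\<in>{1..n}. finite (S i) \<and> X i \<in> M \<rightarrow>\<^sub>M count_space (S i)) \<and>
     finite T \<and> Y \<in> M \<rightarrow>\<^sub>M count_space T"

definition states :: "(nat \<Rightarrow> 'a set) \<Rightarrow> nat set \<Rightarrow> (nat \<Rightarrow> 'a) set" where
  "states S A = (\<Pi>\<^sub>E i\<in>A. S i)"

definition tuple :: "nat \<Rightarrow> (nat \<Rightarrow> 'w \<Rightarrow> 'a) \<Rightarrow> 'w \<Rightarrow> (nat \<Rightarrow> 'a)" where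
  "tuple n X \<omega> = (\<lambda>i\<in>{1..n}. X i \<omega>)"

abbreviation joint_states :: "nat \<Rightarrow> (nat \<Rightarrow> 'a set) \<Rightarrow> 'y set \<Rightarrow> ((nat \<Rightarrow> 'a) \<times> 'y) set" where
  "joint_states n S T \<equiv> states S {1..n} \<times> T"

definition joint_distr ::
  "nat \<Rightarrow> 'w measure \<Rightarrow> (nat \<Rightarrow> 'a set) \<Rightarrow> 'y set \<Rightarrow> (nat \<Rightarrow> 'w \<Rightarrow> 'a) \<Rightarrow> ('w \<Rightarrow> 'y)
     \<Rightarrow> ((nat \<Rightarrow> 'a) \<times> 'y) measure" where
  "joint_distr n M S T X Y =
     distr M (count_space (joint_states n S T)) (\<lambda>\<omega>. (tuple n X \<omega>, Y \<omega>))"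

definition simplicial_complex :: "nat \<Rightarrow> nat set set \<Rightarrow> bool" where
  "simplicial_complex n \<SS> \<longleftrightarrow>
     \<SS> \<noteq> {} \<and> \<SS> \<subseteq> Pow {1..n} \<and> (\<forall>A\<in>\<SS>. \<forall>B. B \<subseteq> A \<longrightarrow> B \<in> \<SS>)"

definition input_lattice :: "nat \<Rightarrow> nat set set set" where
  "input_lattice n = {\<SS>. simplicial_complex n \<SS>}"

text \<open>
  A chain is represented by the set of its elements.  Since \<open>{{}}\<close> and \<open>Pow {1..n}\<close> are
  comparable with every complex, each maximal chain contains both.
\<close>

definition maximal_chains :: "nat \<Rightarrow> nat set set set set" where
  "maximal_chains n = {C. subset.maxchain (input_lattice n) C}"

definition consecutive :: "'a set set \<Rightarrow> 'a set \<Rightarrow> 'a set \<Rightarrow> bool" where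
  "consecutive C U V \<longleftrightarrow>
     U \<in> C \<and> V \<in> C \<and> U \<subset> V \<and> \<not> (\<exists>W\<in>C. U \<subset> W \<and> W \<subset> V)"

definition edges :: "nat \<Rightarrow> nat set \<Rightarrow> (nat set set \<times> nat set set) set" where
  "edges n A = {(\<SS>, \<SS>'). \<SS> \<in> input_lattice n \<and> \<SS>' \<in> input_lattice n \<and>
                           A \<notin> \<SS> \<and> \<SS>' = insert A \<SS>}"

definition num_chains_through :: "nat \<Rightarrow> nat set set \<Rightarrow> nat set set \<Rightarrow> nat" where
  "num_chains_through n \<SS> \<SS>' = card {C \<in> maximal_chains n. consecutive C \<SS> \<SS>'}"

definition input_marginal ::
  "nat \<Rightarrow> (nat \<Rightarrow> 'a set) \<Rightarrow> ((nat \<Rightarrow> 'a) \<times> 'y) measure \<Rightarrow> (nat \<Rightarrow> 'a) measure" where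
  "input_marginal n S q = distr q (count_space (states S {1..n})) fst"

definition subset_marginal ::
  "(nat \<Rightarrow> 'a set) \<Rightarrow> 'y set \<Rightarrow> nat set \<Rightarrow> ((nat \<Rightarrow> 'a) \<times> 'y) measure
     \<Rightarrow> ((nat \<Rightarrow> 'a) \<times> 'y) measure" where
  "subset_marginal S T A q =
     distr q (count_space (states S A \<times> T)) (\<lambda>(x, y). (restrict x A, y))"

text \<open>
  \<open>space (prob_algebra (count_space \<Omega>))\<close> is the set of all probability measures on the
  discrete space \<open>\<Omega>\<close>.
\<close>

definition split_family ::
  "nat \<Rightarrow> (nat \<Rightarrow> 'a set) \<Rightarrow> 'y set \<Rightarrow> ((nat \<Rightarrow> 'a) \<times> 'y) measure \<Rightarrow> nat set set
     \<Rightarrow> ((nat \<Rightarrow> 'a) \<times> 'y) measure set" where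
  "split_family n S T p \<SS> =
     {q \<in> space (prob_algebra (count_space (joint_states n S T))).
        input_marginal n S q = input_marginal n S p \<and>
        (\<forall>A\<in>\<SS>. subset_marginal S T A q = subset_marginal S T A p)}"

text \<open>Shannon entropy of a distribution is the library's entropy of its identity variable.\<close>

definition distr_entropy :: "real \<Rightarrow> 'z set \<Rightarrow> 'z measure \<Rightarrow> real" where
  "distr_entropy b \<Omega> q = prob_space.entropy q b (count_space \<Omega>) (\<lambda>z. z)"

definition split_distr ::
  "real \<Rightarrow> nat \<Rightarrow> (nat \<Rightarrow> 'a set) \<Rightarrow> 'y set \<Rightarrow> ((nat \<Rightarrow> 'a) \<times> 'y) measure \<Rightarrow> nat set set
     \<Rightarrow> ((nat \<Rightarrow> 'a) \<times> 'y) measure" where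
  "split_distr b n S T p \<SS> =
     arg_max_on (distr_entropy b (joint_states n S T)) (split_family n S T p \<SS>)"

text \<open>
  The library puts the reference measure first, so \<open>kl b q r\<close> is the divergence of \<open>q\<close> from \<open>r\<close>.
  The usual finite sums for \<open>kl\<close> and \<open>distr_entropy\<close> are \<open>kl_eq_sum\<close> and
  \<open>distr_entropy_eq_sum\<close> below.
\<close>

definition kl :: "real \<Rightarrow> 'z measure \<Rightarrow> 'z measure \<Rightarrow> real" where
  "kl b q r = KL_divergence b r q"

definition info_contribution ::
  "real \<Rightarrow> nat \<Rightarrow> 'w measure \<Rightarrow> (nat \<Rightarrow> 'a set) \<Rightarrow> 'y set \<Rightarrow> (nat \<Rightarrow> 'w \<Rightarrow> 'a) \<Rightarrow> ('w \<Rightarrow> 'y)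
     \<Rightarrow> nat set \<Rightarrow> real" where
  "info_contribution b n M S T X Y A =
     (let p = joint_distr n M S T X Y in
      1 / real (card (maximal_chains n)) *
      (\<Sum>(\<SS>, \<SS>')\<in>edges n A.
         real (num_chains_through n \<SS> \<SS>') *
         kl b (split_distr b n S T p \<SS>') (split_distr b n S T p \<SS>)))"

definition input_output_information ::
  "real \<Rightarrow> nat \<Rightarrow> 'w measure \<Rightarrow> (nat \<Rightarrow> 'a set) \<Rightarrow> 'y set \<Rightarrow> (nat \<Rightarrow> 'w \<Rightarrow> 'a) \<Rightarrow> ('w \<Rightarrow> 'y)
     \<Rightarrow> real" where
  "input_output_information b n M S T X Y =
     prob_space.mutual_information M b
       (count_space (states S {1..n})) (count_space T) (tuple n X) Y"

lemma distr_entropy_eq_sum: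
  assumes "1 < b" "finite \<Omega>" "q \<in> space (prob_algebra (count_space \<Omega>))"
  shows "distr_entropy b \<Omega> q = - (\<Sum>z\<in>\<Omega>. measure q {z} * log b (measure q {z}))"
proof -
  interpret q: prob_space q using assms(3) by (simp add: space_prob_algebra)
  interpret c: finite_measure "count_space \<Omega>" using assms(2) by (rule finite_measure_count_space)
  have s: "sets q = Pow \<Omega>" using assms(3) by (simp add: space_prob_algebra)
  have q: "density (count_space \<Omega>) (\<lambda>z. ennreal (measure q {z})) = q"
    by (rule measure_eqI_finite[of _ \<Omega>])
      (use assms(2) s in \<open>auto simp: emeasure_density q.emeasure_eq_measure nn_integral_count_space_finite
         indicator_def if_distrib sum.If_cases\<close>)
  have "distr q (count_space \<Omega>) (\<lambda>z. z) = q"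
    by (rule distr_id2) (simp add: s)
  then have "distr_entropy b \<Omega> q = - KL_divergence b (count_space \<Omega>) (density (count_space \<Omega>) (\<lambda>z. ennreal (measure q {z})))"
    by (simp add: distr_entropy_def q.entropy_def q)
  then show ?thesis
    using c.KL_density[of b "\<lambda>z. measure q {z}"] assms
    by (simp add: lebesgue_integral_count_space_finite)
qed

lemma kl_eq_sum:
  assumes "1 < b" "finite \<Omega>"
    and "q \<in> space (prob_algebra (count_space \<Omega>))" "r \<in> space (prob_algebra (count_space \<Omega>))"
    and "\<And>z. z \<in> \<Omega> \<Longrightarrow> measure r {z} = 0 \<Longrightarrow> measure q {z} = 0"
  shows "kl b q r = (\<Sum>z\<in>\<Omega>. measure q {z} * log b (measure q {z} / measure r {z}))"
proof -
  interpret q: prob_space q using assms(3) by (simp add: space_prob_algebra)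
  interpret r: prob_space r using assms(4) by (simp add: space_prob_algebra)
  interpret c: finite_measure "count_space \<Omega>" using assms(2) by (rule finite_measure_count_space)
  have s: "sets q = Pow \<Omega>" "sets r = Pow \<Omega>" using assms(3,4) by (simp_all add: space_prob_algebra)
  have q: "density (count_space \<Omega>) (\<lambda>z. ennreal (measure q {z})) = q"
    by (rule measure_eqI_finite[of _ \<Omega>])
      (use assms(2) s in \<open>auto simp: emeasure_density q.emeasure_eq_measure nn_integral_count_space_finite
         indicator_def if_distrib sum.If_cases\<close>)
  have r: "density (count_space \<Omega>) (\<lambda>z. ennreal (measure r {z})) = r"
    by (rule measure_eqI_finite[of _ \<Omega>])
      (use assms(2) s in \<open>auto simp: emeasure_density r.emeasure_eq_measure nn_integral_count_space_finite
         indicator_def if_distrib sum.If_cases\<close>)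
  show ?thesis
    using c.KL_density_density[of b "\<lambda>z. measure r {z}" "\<lambda>z. measure q {z}"] assms
    by (simp add: kl_def q r AE_count_space lebesgue_integral_count_space_finite)
qed

end

theory Submission
  imports Defs
begin

text \<open>
  Write \<open>h U\<close> for the entropy of the split distribution of the complex \<open>U\<close>.  A maximum entropy
  element \<open>r\<close> of a family cut out by linear constraints dominates every element \<open>q\<close> of the family and
  satisfies the Pythagorean identity \<open>D(q\<parallel>r) = H(r) - H(q)\<close>.  The contribution of \<open>A\<close> is
  therefore a weighted sum of the differences \<open>h U - h (U \<union> {A})\<close>, and only the function \<open>h\<close> matters.
  It is antitone, which gives nonnegativity.  Its differences telescope along every maximal chain, and
  \<open>h {\<emptyset>} - h (2^[n])\<close> is the mutual information because the independent coupling maximises the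
  entropy at the bottom and \<open>p\<close> is the only candidate at the top.  It is equivariant under relabelling
  the inputs.  If \<open>Y\<close> copies the inputs, the constraint of \<open>A\<close> follows from those of its
  singletons, so \<open>h\<close> does not change along the edge.  Finally \<open>h\<close> is additive for independent
  pairs, by subadditivity of entropy and by taking products of the maximisers.
\<close>

section \<open>Minimal negative entropy under linear constraints\<close>

text \<open>The difficulty is the boundary. A maximiser may vanish at some states, where its
  logarithm carries no information and where \<open>kl\<close> reduces to its finite sum only if the
  other distribution vanishes as well. The remedy is that \<open>x * ln x\<close> has slope minus
  infinity at 0: a maximiser can vanish only where every competitor vanishes, since otherwise a
  small step towards that competitor would raise the entropy. On its support the maximiser is then
  interior along every line through a competitor, and the first-order condition there is exactly the
  Pythagorean identity.

  Equality of marginals amounts to finitely many linear equations between probabilities of fibres,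
  which is why the optimisation runs over densities with prescribed sums over events. All maximisers
  share one entropy value, so the choice hidden in \<open>arg_max_on\<close> does not affect
  \<open>h\<close>. Comparisons between different systems all follow one pattern: a map carries a
  maximiser to a competitor on the other side, which gives an inequality, and a map in the opposite
  direction turns it into an equality.\<close>

definition neg_entropy :: "'z set \<Rightarrow> ('z \<Rightarrow> real) \<Rightarrow> real" where
  "neg_entropy \<Omega> f = (\<Sum>z\<in>\<Omega>. f z * ln (f z))"

text \<open>Densities are total functions that vanish off \<open>\<Omega>\<close>. The set therefore
  sits inside a product of compact factors indexed by the whole type, and compactness can come from
  Tychonoff's theorem.\<close>

definition event_densities :: "'z set \<Rightarrow> 'z set set \<Rightarrow> ('z set \<Rightarrow> real) \<Rightarrow> ('z \<Rightarrow> real) set" where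
  "event_densities \<Omega> \<E> c =
     {f. (\<forall>z\<in>\<Omega>. 0 \<le> f z) \<and> (\<forall>z. z \<notin> \<Omega> \<longrightarrow> f z = 0) \<and> sum f \<Omega> = 1 \<and> (\<forall>E\<in>\<E>. sum f E = c E)}"

lemma continuous_on_mult_ln: "continuous_on {0..} (\<lambda>x::real. x * ln x)"
proof -
  have "continuous (at x within {0..}) (\<lambda>x::real. x * ln x)" if "x \<ge> 0" for x
  proof (cases "x = 0")
    case True
    \<comment> \<open>Only 0 is critical: the product takes the value 0 there, which is also its
      limit from the right.\<close>
    have "((\<lambda>x::real. x * ln x) \<longlongrightarrow> 0) (at_right 0)"
      by real_asymp
    then show ?thesis
      by (simp add: True continuous_within at_within_Ici_at_right)
  next
    case False
    then show ?thesis
      using that by (intro continuous_intros) auto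
  qed
  then show ?thesis
    by (auto simp: continuous_on_eq_continuous_within)
qed

text \<open>The left side is the tangent at \<open>c\<close> of the convex function
  \<open>x * ln x\<close>, evaluated at \<open>a\<close>. The bound is
  \<open>ln x \<le> x - 1\<close> at \<open>x = c / a\<close>; for \<open>c = 0\<close> there is no
  tangent, hence the assumption that forces \<open>a = 0\<close>.\<close>

lemma mult_ln_tangent:
  fixes a c :: real
  assumes "0 \<le> a" "0 \<le> c" "c = 0 \<Longrightarrow> a = 0"
  shows "a * ln c + a - c \<le> a * ln a"
proof (cases "a = 0")
  case False
  with assms have pos: "0 < a" "0 < c" by force+
  have "ln (c / a) \<le> c / a - 1"
    using pos by (intro ln_le_minus_one) auto
  then have "a * ln (c / a) \<le> a * (c / a - 1)"
    using pos by (intro mult_left_mono) auto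
  then show ?thesis
    using pos by (simp add: ln_div algebra_simps)
qed (use assms in auto)

text \<open>Both points are compared with the tangent at their mixture, where the linear terms
  cancel on averaging. The weights are strictly positive, so the mixture is 0 only if both points
  are.\<close>

lemma mult_ln_convex:
  fixes a c t :: real
  assumes "0 \<le> a" "0 \<le> c" "0 < t" "t < 1"
  shows "((1 - t) * a + t * c) * ln ((1 - t) * a + t * c) \<le> (1 - t) * (a * ln a) + t * (c * ln c)"
proof -
  define m where "m = (1 - t) * a + t * c"
  have m: "0 \<le> m" "m = 0 \<Longrightarrow> a = 0" "m = 0 \<Longrightarrow> c = 0"
    using assms by (auto simp: m_def add_nonneg_eq_0_iff)
  have "(1 - t) * (a * ln m + a - m) + t * (c * ln m + c - m) \<le> (1 - t) * (a * ln a) + t * (c * ln c)"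
    using assms m by (intro add_mono mult_left_mono mult_ln_tangent) auto
  moreover have "(1 - t) * (a * ln m + a - m) + t * (c * ln m + c - m) = m * ln m"
    unfolding m_def by (simp add: algebra_simps)
  ultimately show ?thesis
    by (simp add: m_def)
qed

text \<open>Sum of the tangent bounds at \<open>g z\<close>; the comparison of total masses absorbs
  the linear terms.\<close>

lemma gibbs_inequality:
  assumes "\<And>z. z \<in> \<Omega> \<Longrightarrow> 0 \<le> f z" "\<And>z. z \<in> \<Omega> \<Longrightarrow> 0 \<le> g z"
    and "\<And>z. z \<in> \<Omega> \<Longrightarrow> g z = 0 \<Longrightarrow> f z = 0" and "sum g \<Omega> \<le> sum f \<Omega>"
  shows "(\<Sum>z\<in>\<Omega>. f z * ln (g z)) \<le> neg_entropy \<Omega> f"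
proof -
  have "(\<Sum>z\<in>\<Omega>. f z * ln (g z) + f z - g z) \<le> neg_entropy \<Omega> f"
    unfolding neg_entropy_def using assms by (intro sum_mono mult_ln_tangent) auto
  then show ?thesis
    using assms(4) by (simp add: sum.distrib sum_subtractf)
qed

text \<open>The constraints are affine, so \<open>t\<close> may leave the unit interval as long as
  positivity survives. Negative \<open>t\<close> is what allows a segment to be prolonged beyond its
  end point.\<close>

lemma event_densities_combine:
  assumes "f \<in> event_densities \<Omega> \<E> c" "g \<in> event_densities \<Omega> \<E> c"
    and "\<And>z. z \<in> \<Omega> \<Longrightarrow> 0 \<le> (1 - t) * f z + t * g z"
  shows "(\<lambda>z. (1 - t) * f z + t * g z) \<in> event_densities \<Omega> \<E> c"
proof -
  have "(\<Sum>z\<in>E. (1 - t) * f z + t * g z) = k" if "sum f E = k" "sum g E = k" for E k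
    using that by (simp add: sum.distrib flip: sum_distrib_left) (simp add: algebra_simps)
  then show ?thesis
    using assms unfolding event_densities_def by auto
qed

lemma event_densities_minimizer_exists:
  assumes fin: "finite \<Omega>" and \<E>: "\<E> \<subseteq> Pow \<Omega>" and ne: "event_densities \<Omega> \<E> c \<noteq> {}"
  obtains f where "f \<in> event_densities \<Omega> \<E> c"
    "\<And>g. g \<in> event_densities \<Omega> \<E> c \<Longrightarrow> neg_entropy \<Omega> f \<le> neg_entropy \<Omega> g"
proof -
  \<comment> \<open>\<open>K\<close> is the compact box and \<open>L\<close> the closed set of the
    linear equations. Off \<open>\<Omega>\<close> the factor is \<open>{0}\<close>, which encodes
    the vanishing there.\<close>
  define K :: "('a \<Rightarrow> real) set" where "K = PiE UNIV (\<lambda>z. if z \<in> \<Omega> then {0..1} else {0})"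
  define L where "L = {f. sum f \<Omega> = 1} \<inter> (\<Inter>E\<in>\<E>. {f :: 'a \<Rightarrow> real. sum f E = c E})"
  have "compactin (product_topology (\<lambda>_. euclidean) UNIV) K"
    unfolding K_def compactin_PiE by auto
  then have "compact K"
    by (simp add: euclidean_product_topology)
  moreover have "closed {f :: 'a \<Rightarrow> real. sum f E = k}" for E k
    by (intro closed_Collect_eq continuous_on_sum continuous_on_const
          continuous_on_product_coordinates)
  then have "closed L"
    unfolding L_def by auto
  ultimately have "compact (K \<inter> L)"
    by (rule compact_Int_closed)
  \<comment> \<open>The upper bound 1 of the box is automatic: nonnegative values with total 1 are
    at most 1.\<close>
  moreover have KL: "event_densities \<Omega> \<E> c = K \<inter> L"
  proof -
    have "f z \<le> 1" if "\<forall>z\<in>\<Omega>. 0 \<le> f z" "sum f \<Omega> = 1" "z \<in> \<Omega>" for f :: "'a \<Rightarrow> real" and z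
      using member_le_sum[of z \<Omega> f] that fin by auto
    then show ?thesis
      by (auto simp: event_densities_def K_def L_def PiE_iff split: if_splits)
  qed
  moreover have "continuous_on (K \<inter> L) (neg_entropy \<Omega>)"
  proof -
    have "continuous_on (K \<inter> L) (\<lambda>f. f z * ln (f z))" if "z \<in> \<Omega>" for z
    proof (rule continuous_on_compose2[OF continuous_on_mult_ln])
      show "continuous_on (K \<inter> L) (\<lambda>f. f z)"
        by (rule continuous_on_subset[OF continuous_on_product_coordinates]) simp
    qed (use that in \<open>auto simp: K_def PiE_iff split: if_splits\<close>)
    then show ?thesis
      unfolding neg_entropy_def by (intro continuous_on_sum) auto
  qed
  ultimately show thesis
    using continuous_attains_inf[of "K \<inter> L" "neg_entropy \<Omega>"] ne that by metis
qed

text \<open>Suppose \<open>g\<close> charges a point that \<open>f\<close> misses. Moving by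
  \<open>t\<close> from \<open>f\<close> towards \<open>g\<close> costs at most \<open>t * d\<close>
  by convexity, but gains a term of order \<open>t * ln t\<close> at that point, which wins for
  small \<open>t\<close>.\<close>

lemma minimizer_dominates:
  assumes fin: "finite \<Omega>" and f: "f \<in> event_densities \<Omega> \<E> c"
    and min: "\<And>g. g \<in> event_densities \<Omega> \<E> c \<Longrightarrow> neg_entropy \<Omega> f \<le> neg_entropy \<Omega> g"
    and g: "g \<in> event_densities \<Omega> \<E> c" and z: "z \<in> \<Omega>" "f z = 0"
  shows "g z = 0"
proof (rule ccontr)
  assume "g z \<noteq> 0"
  have nonneg: "0 \<le> f x" "0 \<le> g x" if "x \<in> \<Omega>" for x
    using f g that by (auto simp: event_densities_def)
  with \<open>g z \<noteq> 0\<close> z have pos: "0 < g z"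
    by fastforce
  define d where "d = neg_entropy \<Omega> g - neg_entropy \<Omega> f"
  have d: "0 \<le> d"
    using min[OF g] by (simp add: d_def)
  \<comment> \<open>Chosen so that \<open>g z * ln t = - (d + 1)\<close>: the gain at
    \<open>z\<close> beats the cost \<open>t * d\<close> by exactly \<open>t\<close>.\<close>
  define t where "t = exp (- (d + 1) / g z)"
  have "- (d + 1) / g z < 0"
    using pos d by (simp add: field_simps)
  then have t: "0 < t" "t < 1"
    by (auto simp: t_def)
  define m where "m x = (1 - t) * f x + t * g x" for x
  have m: "m \<in> event_densities \<Omega> \<E> c"
    unfolding m_def using t nonneg by (intro event_densities_combine f g) auto
  have "neg_entropy \<Omega> m = m z * ln (m z) + (\<Sum>x\<in>\<Omega> - {z}. m x * ln (m x))"
    unfolding neg_entropy_def using fin z(1) by (rule sum.remove)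
  \<comment> \<open>Since \<open>f z = 0\<close>, the mixture at \<open>z\<close> is
    \<open>t * g z\<close>, and the logarithm of the product yields the additional
    \<open>ln t\<close>. At all other points convexity suffices.\<close>
  also have "m z * ln (m z) = (1 - t) * (f z * ln (f z)) + t * (g z * ln (g z)) + t * g z * ln t"
    using z(2) pos t by (simp add: m_def ln_mult algebra_simps)
  also have "(\<Sum>x\<in>\<Omega> - {z}. m x * ln (m x)) \<le>
      (\<Sum>x\<in>\<Omega> - {z}. (1 - t) * (f x * ln (f x)) + t * (g x * ln (g x)))"
    unfolding m_def using t nonneg by (intro sum_mono mult_ln_convex) auto
  also have "(1 - t) * (f z * ln (f z)) + t * (g z * ln (g z)) + t * g z * ln t + \<dots> =
      (\<Sum>x\<in>\<Omega>. (1 - t) * (f x * ln (f x)) + t * (g x * ln (g x))) + t * g z * ln t"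
    by (subst sum.remove[OF fin z(1)]) simp
  also have "(\<Sum>x\<in>\<Omega>. (1 - t) * (f x * ln (f x)) + t * (g x * ln (g x))) = neg_entropy \<Omega> f + t * d"
    by (simp add: neg_entropy_def d_def sum.distrib flip: sum_distrib_left) (simp add: algebra_simps)
  also have "t * g z * ln t = - t * (d + 1)"
  proof -
    have "g z * ln t = - (d + 1)"
      using pos by (simp add: t_def)
    then show ?thesis
      by (simp add: mult.assoc) (simp add: algebra_simps)
  qed
  finally have "neg_entropy \<Omega> m \<le> neg_entropy \<Omega> f - t"
    by (simp add: algebra_simps)
  with min[OF m] t show False
    by simp
qed

text \<open>
  As \<open>f\<close> dominates \<open>g\<close>, the segment from \<open>g\<close> to \<open>f\<close> can be prolonged beyond \<open>f\<close> within the
  family, so that the derivative at \<open>f\<close> along this line vanishes.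
\<close>

lemma minimizer_pythagoras:
  assumes fin: "finite \<Omega>" and f: "f \<in> event_densities \<Omega> \<E> c"
    and min: "\<And>g. g \<in> event_densities \<Omega> \<E> c \<Longrightarrow> neg_entropy \<Omega> f \<le> neg_entropy \<Omega> g"
    and g: "g \<in> event_densities \<Omega> \<E> c"
  shows "(\<Sum>z\<in>\<Omega>. g z * ln (f z)) = neg_entropy \<Omega> f"
proof -
  \<comment> \<open>On the support of \<open>f\<close> every summand is differentiable at
    \<open>t = 0\<close>; off the support both densities vanish, so nothing is lost.\<close>
  define \<Omega>1 where "\<Omega>1 = {z\<in>\<Omega>. f z \<noteq> 0}"
  have nonneg: "0 \<le> f x" "0 \<le> g x" if "x \<in> \<Omega>" for x
    using f g that by (auto simp: event_densities_def)
  have sums: "sum f \<Omega> = 1" "sum g \<Omega> = 1"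
    using f g by (auto simp: event_densities_def)
  have fin1: "finite \<Omega>1" and pos: "\<And>z. z \<in> \<Omega>1 \<Longrightarrow> 0 < f z"
    using fin nonneg by (auto simp: \<Omega>1_def order_le_less)
  have gle: "g z \<le> 1" if "z \<in> \<Omega>" for z
    using member_le_sum[of z \<Omega> g] that fin nonneg sums by auto
  have fle: "f z \<le> 1" if "z \<in> \<Omega>" for z
    using member_le_sum[of z \<Omega> f] that fin nonneg sums by auto
  have zero: "g z = 0" if "z \<in> \<Omega>" "f z = 0" for z
    using minimizer_dominates[OF fin f min g that] .
  have ne1: "\<Omega>1 \<noteq> {}"
  proof
    assume "\<Omega>1 = {}"
    then have "sum f \<Omega> = 0"
      by (intro sum.neutral) (auto simp: \<Omega>1_def)
    with sums show False by simp
  qed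
  \<comment> \<open>Two values in the unit interval differ by at most 1, so a step shorter than the
    least positive value of \<open>f\<close> keeps the combination nonnegative.\<close>
  define \<epsilon> where "\<epsilon> = Min (f ` \<Omega>1)"
  have \<epsilon>: "0 < \<epsilon>" "\<And>z. z \<in> \<Omega>1 \<Longrightarrow> \<epsilon> \<le> f z"
    using fin1 ne1 pos by (auto simp: \<epsilon>_def)
  define m where "m t x = (1 - t) * f x + t * g x" for t x
  define \<phi> where "\<phi> t = (\<Sum>z\<in>\<Omega>1. m t z * ln (m t z))" for t
  have \<phi>: "\<phi> t = neg_entropy \<Omega> (m t)" for t
    unfolding neg_entropy_def \<phi>_def using zero fin
    by (intro sum.mono_neutral_left) (auto simp: \<Omega>1_def m_def)
  have "\<phi> 0 \<le> \<phi> t" if "\<bar>0 - t\<bar> < \<epsilon>" for t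
  proof -
    have "0 \<le> m t z" if z: "z \<in> \<Omega>" for z
    proof (cases "z \<in> \<Omega>1")
      case True
      have "\<bar>t * (g z - f z)\<bar> \<le> \<epsilon> * 1"
        unfolding abs_mult using \<open>\<bar>0 - t\<bar> < \<epsilon>\<close> gle[OF z] fle[OF z] nonneg[OF z]
        by (intro mult_mono) auto
      then show ?thesis
        using \<epsilon>(2)[OF True] by (simp add: m_def algebra_simps)
    qed (use zero z in \<open>auto simp: \<Omega>1_def m_def\<close>)
    then have "m t \<in> event_densities \<Omega> \<E> c"
      unfolding m_def by (intro event_densities_combine f g) auto
    moreover have "m 0 = f"
      by (simp add: m_def fun_eq_iff)
    ultimately show ?thesis
      using min by (simp add: \<phi>)
  qed
  moreover have "DERIV \<phi> 0 :> (\<Sum>z\<in>\<Omega>1. (g z - f z) * ln (f z) + (g z - f z))"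
    unfolding \<phi>_def m_def
  proof (rule DERIV_sum)
    fix z assume "z \<in> \<Omega>1"
    with pos have "0 < f z" by auto
    then show "((\<lambda>t. ((1 - t) * f z + t * g z) * ln ((1 - t) * f z + t * g z)) has_real_derivative
        (g z - f z) * ln (f z) + (g z - f z)) (at 0)"
      by (auto intro!: derivative_eq_intros)
  qed
  ultimately have "(\<Sum>z\<in>\<Omega>1. (g z - f z) * ln (f z) + (g z - f z)) = 0"
    using DERIV_local_min[OF _ \<epsilon>(1)] by blast
  also have "(\<Sum>z\<in>\<Omega>1. (g z - f z) * ln (f z) + (g z - f z)) =
      (\<Sum>z\<in>\<Omega>. (g z - f z) * ln (f z) + (g z - f z))"
    using zero fin by (intro sum.mono_neutral_left) (auto simp: \<Omega>1_def)
  \<comment> \<open>The terms \<open>g z - f z\<close> sum to 0 because both masses are 1, so only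
    the logarithmic part of the derivative remains.\<close>
  finally show ?thesis
    using sums by (simp add: neg_entropy_def sum.distrib sum_subtractf algebra_simps)
qed

section \<open>Distributions on finite sets\<close>

abbreviation distributions :: "'z set \<Rightarrow> 'z measure set" where
  "distributions \<Omega> \<equiv> space (prob_algebra (count_space \<Omega>))"

lemma distributionsD:
  assumes "q \<in> distributions \<Omega>"
  shows "prob_space q" "sets q = Pow \<Omega>" "space q = \<Omega>"
  using assms sets_eq_imp_space_eq[of q "count_space \<Omega>"] by (auto simp: space_prob_algebra)

lemma distributions_measure_eq_sum:
  assumes "q \<in> distributions \<Omega>" "finite \<Omega>" "E \<subseteq> \<Omega>"
  shows "measure q E = (\<Sum>z\<in>E. measure q {z})"
proof -
  interpret prob_space q using distributionsD(1)[OF assms(1)] .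
  show ?thesis
    using assms distributionsD(2)[OF assms(1)]
    by (intro finite_measure_eq_sum_singleton) (auto intro: finite_subset)
qed

lemma distributions_eqI:
  assumes "q \<in> distributions \<Omega>" "r \<in> distributions \<Omega>" "finite \<Omega>"
    and "\<And>z. z \<in> \<Omega> \<Longrightarrow> measure q {z} = measure r {z}"
  shows "q = r"
proof (rule measure_eqI_finite)
  interpret q: prob_space q using distributionsD(1)[OF assms(1)] .
  interpret r: prob_space r using distributionsD(1)[OF assms(2)] .
  fix z assume "z \<in> \<Omega>"
  then show "emeasure q {z} = emeasure r {z}"
    using assms(4) by (simp add: q.emeasure_eq_measure r.emeasure_eq_measure)
qed (use assms(3) distributionsD(2)[OF assms(1)] distributionsD(2)[OF assms(2)] in auto)

lemma distributions_measurable: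
  assumes "q \<in> distributions \<Omega>" "g \<in> \<Omega> \<rightarrow> \<Omega>'"
  shows "g \<in> q \<rightarrow>\<^sub>M count_space \<Omega>'"
  using assms distributionsD[OF assms(1)] by (auto simp: measurable_def)

lemma distr_in_distributions:
  assumes "q \<in> distributions \<Omega>" "g \<in> \<Omega> \<rightarrow> \<Omega>'"
  shows "distr q (count_space \<Omega>') g \<in> distributions \<Omega>'"
proof -
  interpret prob_space q using distributionsD(1)[OF assms(1)] .
  show ?thesis
    using prob_space_distr[OF distributions_measurable[OF assms]] by (simp add: space_prob_algebra)
qed

lemma measure_distr_singleton:
  assumes "q \<in> distributions \<Omega>" "g \<in> \<Omega> \<rightarrow> \<Omega>'" "w \<in> \<Omega>'"
  shows "measure (distr q (count_space \<Omega>') g) {w} = measure q {z\<in>\<Omega>. g z = w}"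
  using measure_distr[OF distributions_measurable[OF assms(1,2)], of "{w}"] assms(3)
    distributionsD(3)[OF assms(1)]
  by (simp add: vimage_def Int_def conj_commute)

text \<open>Turns an equation between image measures into finitely many linear equations on event
  probabilities, the form in which the optimisation results apply.\<close>

lemma distr_eq_iff_measure_fibres:
  assumes "q \<in> distributions \<Omega>" "r \<in> distributions \<Omega>" "g \<in> \<Omega> \<rightarrow> \<Omega>'" "finite \<Omega>'"
  shows "distr q (count_space \<Omega>') g = distr r (count_space \<Omega>') g \<longleftrightarrow>
    (\<forall>w\<in>\<Omega>'. measure q {z\<in>\<Omega>. g z = w} = measure r {z\<in>\<Omega>. g z = w})"
    (is "?l \<longleftrightarrow> ?r")
proof
  assume ?l
  then show ?r
    using measure_distr_singleton[OF assms(1,3)] measure_distr_singleton[OF assms(2,3)] by metis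
next
  assume ?r
  then show ?l
    using assms measure_distr_singleton[OF assms(1,3)] measure_distr_singleton[OF assms(2,3)]
    by (intro distributions_eqI[where \<Omega> = \<Omega>'] distr_in_distributions) auto
qed

lemma point_measure_in_distributions:
  assumes "finite \<Omega>" "\<And>z. z \<in> \<Omega> \<Longrightarrow> 0 \<le> f z" "sum f \<Omega> = (1 :: real)"
  shows "point_measure \<Omega> (\<lambda>z. ennreal (f z)) \<in> distributions \<Omega>"
    and "z \<in> \<Omega> \<Longrightarrow> measure (point_measure \<Omega> (\<lambda>z. ennreal (f z))) {z} = f z"
proof -
  have "emeasure (point_measure \<Omega> (\<lambda>z. ennreal (f z))) \<Omega> = 1"
    using assms by (simp add: emeasure_point_measure_finite sum_ennreal)
  then show "point_measure \<Omega> (\<lambda>z. ennreal (f z)) \<in> distributions \<Omega>"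
    by (auto simp: space_prob_algebra space_point_measure sets_point_measure intro!: prob_spaceI)
  show "measure (point_measure \<Omega> (\<lambda>z. ennreal (f z))) {z} = f z" if "z \<in> \<Omega>"
    using assms that by (simp add: measure_def emeasure_point_measure_finite)
qed

lemma distr_entropy_eq_neg_entropy:
  assumes "1 < b" "finite \<Omega>" "q \<in> distributions \<Omega>"
  shows "distr_entropy b \<Omega> q = - neg_entropy \<Omega> (\<lambda>z. measure q {z}) / ln b"
  using distr_entropy_eq_sum[OF assms]
  by (simp add: neg_entropy_def log_def flip: sum_divide_distrib)

section \<open>Entropy maximisers under prescribed event probabilities\<close>

definition event_family :: "'z set \<Rightarrow> 'z set set \<Rightarrow> 'z measure \<Rightarrow> 'z measure set" where
  "event_family \<Omega> \<E> p = {q \<in> distributions \<Omega>. \<forall>E\<in>\<E>. measure q E = measure p E}"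

lemma event_family_densities:
  assumes "finite \<Omega>" "\<E> \<subseteq> Pow \<Omega>" "q \<in> event_family \<Omega> \<E> p"
  shows "(\<lambda>z. if z \<in> \<Omega> then measure q {z} else 0) \<in> event_densities \<Omega> \<E> (measure p)"
proof -
  have q: "q \<in> distributions \<Omega>"
    using assms(3) by (simp add: event_family_def)
  interpret prob_space q using distributionsD(1)[OF q] .
  have sum_eq: "(\<Sum>z\<in>E. if z \<in> \<Omega> then measure q {z} else 0) = measure q E" if "E \<subseteq> \<Omega>" for E
    unfolding distributions_measure_eq_sum[OF q assms(1) that] using that
    by (intro sum.cong) auto
  have "measure q \<Omega> = 1"
    using prob_space distributionsD(3)[OF q] by simp
  moreover have "\<forall>E\<in>\<E>. measure q E = measure p E"
    using assms(3) by (simp add: event_family_def)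
  ultimately show ?thesis
    unfolding event_densities_def using assms(2)
    by (intro CollectI conjI ballI allI impI)
      (auto simp: sum_eq[OF order_refl, simplified] sum_eq)
qed

lemma densities_event_family:
  assumes "finite \<Omega>" "\<E> \<subseteq> Pow \<Omega>" "f \<in> event_densities \<Omega> \<E> (measure p)"
  shows "point_measure \<Omega> (\<lambda>z. ennreal (f z)) \<in> event_family \<Omega> \<E> p"
proof -
  let ?q = "point_measure \<Omega> (\<lambda>z. ennreal (f z))"
  have f: "\<And>z. z \<in> \<Omega> \<Longrightarrow> 0 \<le> f z" "sum f \<Omega> = 1" "\<And>E. E \<in> \<E> \<Longrightarrow> sum f E = measure p E"
    using assms(3) by (auto simp: event_densities_def)
  note q = point_measure_in_distributions[OF assms(1) f(1,2)]
  have "measure ?q E = measure p E" if "E \<in> \<E>" for E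
  proof -
    have "E \<subseteq> \<Omega>" using that assms(2) by auto
    moreover have "?q \<in> distributions \<Omega>"
      using q(1) by simp
    ultimately have "measure ?q E = (\<Sum>z\<in>E. measure ?q {z})"
      using assms(1) by (intro distributions_measure_eq_sum)
    also have "\<dots> = sum f E"
      using q(2) \<open>E \<subseteq> \<Omega>\<close> by (intro sum.cong) auto
    finally have "measure ?q E = sum f E" .
    then show ?thesis using f(3)[OF that] by simp
  qed
  then show ?thesis
    using q(1) by (simp add: event_family_def)
qed

lemma event_family_entropy_maximizer:
  assumes b: "1 < b" and fin: "finite \<Omega>" and \<E>: "\<E> \<subseteq> Pow \<Omega>" and p: "p \<in> distributions \<Omega>"
  shows "\<exists>r. is_arg_max (distr_entropy b \<Omega>) (\<lambda>q. q \<in> event_family \<Omega> \<E> p) r"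
proof -
  let ?d = "\<lambda>q z. if z \<in> \<Omega> then measure q {z} else 0"
  have "p \<in> event_family \<Omega> \<E> p"
    using p by (simp add: event_family_def)
  then have "event_densities \<Omega> \<E> (measure p) \<noteq> {}"
    using event_family_densities[OF fin \<E>] by blast
  then obtain f where f: "f \<in> event_densities \<Omega> \<E> (measure p)"
    and min: "\<And>g. g \<in> event_densities \<Omega> \<E> (measure p) \<Longrightarrow> neg_entropy \<Omega> f \<le> neg_entropy \<Omega> g"
    using event_densities_minimizer_exists[OF fin \<E>] by metis
  let ?r = "point_measure \<Omega> (\<lambda>z. ennreal (f z))"
  have "\<And>z. z \<in> \<Omega> \<Longrightarrow> 0 \<le> f z" "sum f \<Omega> = 1"
    using f by (auto simp: event_densities_def)
  note r = point_measure_in_distributions[OF fin this]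
  have rf: "neg_entropy \<Omega> (\<lambda>z. measure ?r {z}) = neg_entropy \<Omega> f"
    unfolding neg_entropy_def using r(2) by (intro sum.cong) auto
  have "distr_entropy b \<Omega> q \<le> distr_entropy b \<Omega> ?r" if q: "q \<in> event_family \<Omega> \<E> p" for q
  proof -
    have "neg_entropy \<Omega> f \<le> neg_entropy \<Omega> (?d q)"
      using min event_family_densities[OF fin \<E> q] by blast
    also have "\<dots> = neg_entropy \<Omega> (\<lambda>z. measure q {z})"
      unfolding neg_entropy_def by (intro sum.cong) auto
    finally show ?thesis
      using b q r(1) rf by (simp add: event_family_def distr_entropy_eq_neg_entropy[OF b fin] divide_right_mono)
  qed
  then show ?thesis
    using densities_event_family[OF fin \<E> f] unfolding is_arg_max_linorder by blast
qed

text \<open>The divergence is the cross term \<open>q * ln r\<close> subtracted from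
  \<open>q * ln q\<close>; by the Pythagorean identity the cross term may be evaluated with
  \<open>r\<close> in place of \<open>q\<close>. Stated for every maximiser, so that it covers both
  the chosen \<open>split_distr\<close> and an explicitly given product.\<close>

lemma kl_entropy_maximizer:
  assumes b: "1 < b" and fin: "finite \<Omega>" and \<E>: "\<E> \<subseteq> Pow \<Omega>"
    and r: "is_arg_max (distr_entropy b \<Omega>) (\<lambda>q. q \<in> event_family \<Omega> \<E> p) r"
    and q: "q \<in> event_family \<Omega> \<E> p"
  shows "kl b q r = distr_entropy b \<Omega> r - distr_entropy b \<Omega> q"
proof -
  let ?d = "\<lambda>q z. if z \<in> \<Omega> then measure q {z} else 0"
  have d: "neg_entropy \<Omega> (?d q) = neg_entropy \<Omega> (\<lambda>z. measure q {z})" for q :: "'a measure"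
    unfolding neg_entropy_def by (intro sum.cong) auto
  have r': "r \<in> event_family \<Omega> \<E> p"
    using r by (simp add: is_arg_max_def)
  have P: "q \<in> distributions \<Omega>" "r \<in> distributions \<Omega>"
    using q r' by (auto simp: event_family_def)
  \<comment> \<open>The minimisation results quantify over densities, so each competing density is
    realised as a point measure before the maximality of \<open>r\<close> is used.\<close>
  have min: "neg_entropy \<Omega> (?d r) \<le> neg_entropy \<Omega> g"
    if g: "g \<in> event_densities \<Omega> \<E> (measure p)" for g
  proof -
    let ?g = "point_measure \<Omega> (\<lambda>z. ennreal (g z))"
    have "\<And>z. z \<in> \<Omega> \<Longrightarrow> 0 \<le> g z" "sum g \<Omega> = 1"
      using g by (auto simp: event_densities_def)
    note G = point_measure_in_distributions[OF fin this]
    have gg: "neg_entropy \<Omega> (\<lambda>z. measure ?g {z}) = neg_entropy \<Omega> g"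
      unfolding neg_entropy_def using G(2) by (intro sum.cong) auto
    have "distr_entropy b \<Omega> ?g \<le> distr_entropy b \<Omega> r"
      using r densities_event_family[OF fin \<E> g] by (simp add: is_arg_max_linorder)
    then show ?thesis
      using b by (simp add: distr_entropy_eq_neg_entropy[OF b fin] P G gg d divide_le_cancel)
  qed
  note rd = event_family_densities[OF fin \<E> r']
  note qd = event_family_densities[OF fin \<E> q]
  have dom: "measure q {z} = 0" if "z \<in> \<Omega>" "measure r {z} = 0" for z
    using minimizer_dominates[OF fin rd min qd that(1)] that by simp
  have "kl b q r = (\<Sum>z\<in>\<Omega>. measure q {z} * log b (measure q {z} / measure r {z}))"
    using kl_eq_sum[OF b fin P dom] .
  also have "\<dots> = (\<Sum>z\<in>\<Omega>. (?d q z * ln (?d q z) - ?d q z * ln (?d r z)) / ln b)"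
  proof (rule sum.cong)
    fix z assume z: "z \<in> \<Omega>"
    show "measure q {z} * log b (measure q {z} / measure r {z}) =
        (?d q z * ln (?d q z) - ?d q z * ln (?d r z)) / ln b"
    \<comment> \<open>The logarithm of the quotient splits only where both masses are positive;
      domination reduces this to \<open>q\<close> being positive.\<close>
    proof (cases "measure q {z} = 0")
      case False
      then have "0 < measure q {z}" "0 < measure r {z}"
        using dom[OF z] by (auto simp: zero_less_measure_iff)
      then show ?thesis
        using z by (simp add: log_def ln_div algebra_simps diff_divide_distrib)
    qed (use z in simp)
  qed simp
  also have "\<dots> = (neg_entropy \<Omega> (?d q) - (\<Sum>z\<in>\<Omega>. ?d q z * ln (?d r z))) / ln b"
    unfolding neg_entropy_def by (simp only: sum_subtractf sum_divide_distrib[symmetric])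
  also have "(\<Sum>z\<in>\<Omega>. ?d q z * ln (?d r z)) = neg_entropy \<Omega> (?d r)"
    by (rule minimizer_pythagoras[OF fin rd min qd])
  finally show ?thesis
    using P by (simp add: d distr_entropy_eq_neg_entropy[OF b fin] diff_divide_distrib)
qed

section \<open>Entropy of bijective images, products and marginals\<close>

lemma distr_entropy_bij:
  assumes b: "1 < b" and fin: "finite \<Omega>" and q: "q \<in> distributions \<Omega>" and \<phi>: "bij_betw \<phi> \<Omega> \<Omega>'"
  shows "distr_entropy b \<Omega>' (distr q (count_space \<Omega>') \<phi>) = distr_entropy b \<Omega> q"
proof -
  have fin': "finite \<Omega>'" and \<phi>': "\<phi> \<in> \<Omega> \<rightarrow> \<Omega>'"
    using \<phi> fin by (auto simp: bij_betw_def)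
  have "measure (distr q (count_space \<Omega>') \<phi>) {\<phi> z} = measure q {z}" if "z \<in> \<Omega>" for z
  proof -
    have "{x\<in>\<Omega>. \<phi> x = \<phi> z} = {z}"
      using \<phi> that by (auto simp: bij_betw_def dest: inj_onD)
    then show ?thesis
      using measure_distr_singleton[OF q \<phi>', of "\<phi> z"] \<phi>' that by auto
  qed
  then show ?thesis
    unfolding distr_entropy_eq_sum[OF b fin' distr_in_distributions[OF q \<phi>']] distr_entropy_eq_sum[OF b fin q]
    by (subst sum.reindex_bij_betw[OF \<phi>, symmetric]) simp
qed

lemma pair_measure_in_distributions:
  assumes "q \<in> distributions \<Omega>" "r \<in> distributions \<Omega>'" "finite \<Omega>" "finite \<Omega>'"
  shows "q \<Otimes>\<^sub>M r \<in> distributions (\<Omega> \<times> \<Omega>')"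
    and "measure (q \<Otimes>\<^sub>M r) {(x, y)} = measure q {x} * measure r {y}"
proof -
  interpret q: prob_space q using distributionsD(1)[OF assms(1)] .
  interpret r: prob_space r using distributionsD(1)[OF assms(2)] .
  interpret pair_prob_space q r ..
  have "sets (q \<Otimes>\<^sub>M r) = sets (count_space \<Omega> \<Otimes>\<^sub>M count_space \<Omega>')"
    using assms by (intro sets_pair_measure_cong) (auto simp: space_prob_algebra)
  also have "\<dots> = Pow (\<Omega> \<times> \<Omega>')"
    using pair_measure_count_space[OF assms(3,4)] by (simp only: sets_count_space)
  finally show "q \<Otimes>\<^sub>M r \<in> distributions (\<Omega> \<times> \<Omega>')"
    by (simp add: space_prob_algebra prob_space_axioms)
  show "measure (q \<Otimes>\<^sub>M r) {(x, y)} = measure q {x} * measure r {y}"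
  proof (cases "x \<in> \<Omega> \<and> y \<in> \<Omega>'")
    case True
    then have "measure (q \<Otimes>\<^sub>M r) ({x} \<times> {y}) = measure q {x} * measure r {y}"
      using distributionsD[OF assms(1)] distributionsD[OF assms(2)]
      by (simp add: measure_def r.emeasure_pair_measure_Times enn2real_mult del: Times_insert_left Times_insert_right insert_Times_insert)
    then show ?thesis by simp
  next
    \<comment> \<open>Outside the state sets singletons are not measurable and get measure 0 by
      convention, so the product formula holds for all \<open>x\<close> and
      \<open>y\<close>.\<close>
    case False
    then have "{(x, y)} \<notin> sets (q \<Otimes>\<^sub>M r)" "{x} \<notin> sets q \<or> {y} \<notin> sets r"
      using distributionsD[OF assms(1)] distributionsD[OF assms(2)]
        distributionsD(2)[OF \<open>q \<Otimes>\<^sub>M r \<in> distributions (\<Omega> \<times> \<Omega>')\<close>]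
      by auto
    then show ?thesis
      by (auto simp: measure_notin_sets)
  qed
qed

lemma sum_marginal:
  assumes q: "q \<in> distributions \<Omega>" and fin: "finite \<Omega>" "finite \<Omega>'" and g: "g \<in> \<Omega> \<rightarrow> \<Omega>'"
  shows "(\<Sum>w\<in>\<Omega>'. measure (distr q (count_space \<Omega>') g) {w} * f w) = (\<Sum>z\<in>\<Omega>. measure q {z} * f (g z))"
proof -
  have "(\<Sum>z\<in>\<Omega>. measure q {z} * f (g z)) = (\<Sum>w\<in>\<Omega>'. \<Sum>z\<in>{z\<in>\<Omega>. g z = w}. measure q {z} * f (g z))"
    using g by (intro sum.group[OF fin, symmetric]) auto
  also have "\<dots> = (\<Sum>w\<in>\<Omega>'. measure (distr q (count_space \<Omega>') g) {w} * f w)"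
  proof (rule sum.cong)
    fix w assume w: "w \<in> \<Omega>'"
    have "measure (distr q (count_space \<Omega>') g) {w} = (\<Sum>z\<in>{z\<in>\<Omega>. g z = w}. measure q {z})"
      unfolding measure_distr_singleton[OF q g w]
      by (intro distributions_measure_eq_sum[OF q fin(1)]) auto
    then show "(\<Sum>z\<in>{z\<in>\<Omega>. g z = w}. measure q {z} * f (g z)) = measure (distr q (count_space \<Omega>') g) {w} * f w"
      by (simp add: sum_distrib_right)
  qed simp
  finally show ?thesis ..
qed

lemma marginals_pair_measure:
  assumes "q \<in> distributions \<Omega>" "r \<in> distributions \<Omega>'"
  shows "distr (q \<Otimes>\<^sub>M r) (count_space \<Omega>) fst = q" "distr (q \<Otimes>\<^sub>M r) (count_space \<Omega>') snd = r"
proof -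
  interpret q: prob_space q using distributionsD(1)[OF assms(1)] .
  interpret r: prob_space r using distributionsD(1)[OF assms(2)] .
  interpret pair_prob_space q r ..
  have "distr (q \<Otimes>\<^sub>M r) (count_space \<Omega>) fst = distr (q \<Otimes>\<^sub>M r) q fst"
    using distributionsD(2)[OF assms(1)] by (intro distr_cong) auto
  then show "distr (q \<Otimes>\<^sub>M r) (count_space \<Omega>) fst = q"
    by (simp add: r.distr_pair_fst)
  have "distr (q \<Otimes>\<^sub>M r) (count_space \<Omega>') snd = distr (q \<Otimes>\<^sub>M r) r (fst \<circ> (\<lambda>(x, y). (y, x)))"
    using distributionsD(2)[OF assms(2)] by (intro distr_cong) auto
  also have "\<dots> = distr (distr (q \<Otimes>\<^sub>M r) (r \<Otimes>\<^sub>M q) (\<lambda>(x, y). (y, x))) r fst"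
    by (subst distr_distr) auto
  also have "\<dots> = distr (r \<Otimes>\<^sub>M q) r fst"
    using pair_sigma_finite.distr_pair_swap[of r q]
    by (simp add: pair_sigma_finite_def q.sigma_finite_measure_axioms r.sigma_finite_measure_axioms)
  also have "\<dots> = r"
    by (rule q.distr_pair_fst)
  finally show "distr (q \<Otimes>\<^sub>M r) (count_space \<Omega>') snd = r" .
qed

text \<open>The logarithm of the product density is a sum of functions of one coordinate each, and
  their expectations under \<open>q\<close> depend only on the marginals. The second claim supplies
  the domination for Gibbs' inequality.\<close>

lemma cross_entropy_marginals:
  assumes b: "1 < b" and fin: "finite \<Omega>" "finite \<Omega>'" and q: "q \<in> distributions (\<Omega> \<times> \<Omega>')"
    and r: "r = distr q (count_space \<Omega>) fst" and s: "s = distr q (count_space \<Omega>') snd"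
  shows "(\<Sum>z\<in>\<Omega> \<times> \<Omega>'. measure q {z} * ln (measure (r \<Otimes>\<^sub>M s) {z})) / ln b =
      - (distr_entropy b \<Omega> r + distr_entropy b \<Omega>' s)"
    and "z \<in> \<Omega> \<times> \<Omega>' \<Longrightarrow> measure (r \<Otimes>\<^sub>M s) {z} = 0 \<Longrightarrow> measure q {z} = 0"
proof -
  have f: "fst \<in> \<Omega> \<times> \<Omega>' \<rightarrow> \<Omega>" "snd \<in> \<Omega> \<times> \<Omega>' \<rightarrow> \<Omega>'" by auto
  have fin': "finite (\<Omega> \<times> \<Omega>')" using fin by auto
  have rs: "r \<in> distributions \<Omega>" "s \<in> distributions \<Omega>'"
    unfolding r s using q by (auto intro!: distr_in_distributions[where \<Omega> = "\<Omega> \<times> \<Omega>'"])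
  interpret prob_space q using distributionsD(1)[OF q] .
  \<comment> \<open>A point is contained in its fibre under either projection, so \<open>q\<close>
    vanishes wherever one of its marginals does.\<close>
  have le: "measure q {z} \<le> measure r {fst z}" "measure q {z} \<le> measure s {snd z}"
    if "z \<in> \<Omega> \<times> \<Omega>'" for z
    unfolding r s using that distributionsD(2)[OF q]
    by (auto simp: measure_distr_singleton[OF q f(1)] measure_distr_singleton[OF q f(2)] intro!: finite_measure_mono)
  show zero: "measure q {z} = 0" if "z \<in> \<Omega> \<times> \<Omega>'" "measure (r \<Otimes>\<^sub>M s) {z} = 0" for z
    using le[OF that(1)] that(2) pair_measure_in_distributions(2)[OF rs fin, of "fst z" "snd z"]
      measure_nonneg[of q "{z}"] by (auto intro: antisym)
  have "(\<Sum>z\<in>\<Omega> \<times> \<Omega>'. measure q {z} * ln (measure (r \<Otimes>\<^sub>M s) {z})) =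
      (\<Sum>z\<in>\<Omega> \<times> \<Omega>'. measure q {z} * ln (measure r {fst z}) + measure q {z} * ln (measure s {snd z}))"
  proof (rule sum.cong)
    fix z assume z: "z \<in> \<Omega> \<times> \<Omega>'"
    show "measure q {z} * ln (measure (r \<Otimes>\<^sub>M s) {z}) =
        measure q {z} * ln (measure r {fst z}) + measure q {z} * ln (measure s {snd z})"
    proof (cases "measure q {z} = 0")
      case False
      then have "0 < measure r {fst z}" "0 < measure s {snd z}"
        using le[OF z] measure_nonneg[of q "{z}"] by linarith+
      then show ?thesis
        using pair_measure_in_distributions(2)[OF rs fin, of "fst z" "snd z"]
        by (simp add: ln_mult algebra_simps)
    qed simp
  qed simp
  also have "\<dots> = neg_entropy \<Omega> (\<lambda>x. measure r {x}) + neg_entropy \<Omega>' (\<lambda>x. measure s {x})"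
    unfolding sum.distrib neg_entropy_def r s
    sum_marginal[OF q fin' fin(1) f(1)] sum_marginal[OF q fin' fin(2) f(2)] ..
  finally show "(\<Sum>z\<in>\<Omega> \<times> \<Omega>'. measure q {z} * ln (measure (r \<Otimes>\<^sub>M s) {z})) / ln b =
      - (distr_entropy b \<Omega> r + distr_entropy b \<Omega>' s)"
    by (simp add: distr_entropy_eq_neg_entropy[OF b] fin rs add_divide_distrib)
qed

text \<open>The cross entropy formula with \<open>q\<close> equal to the product itself, whose
  marginals are \<open>r\<close> and \<open>s\<close>.\<close>

lemma distr_entropy_pair_measure:
  assumes b: "1 < b" and fin: "finite \<Omega>" "finite \<Omega>'"
    and rs: "r \<in> distributions \<Omega>" "s \<in> distributions \<Omega>'"
  shows "distr_entropy b (\<Omega> \<times> \<Omega>') (r \<Otimes>\<^sub>M s) = distr_entropy b \<Omega> r + distr_entropy b \<Omega>' s"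
  using cross_entropy_marginals(1)[OF b fin pair_measure_in_distributions(1)[OF rs fin],
      unfolded marginals_pair_measure[OF rs], OF refl refl]
  by (simp add: distr_entropy_eq_neg_entropy[OF b _ pair_measure_in_distributions(1)[OF rs fin]] fin
      neg_entropy_def)

text \<open>Gibbs' inequality for \<open>q\<close> against the product of its own marginals.\<close>

lemma distr_entropy_le_marginals:
  assumes b: "1 < b" and fin: "finite \<Omega>" "finite \<Omega>'" and q: "q \<in> distributions (\<Omega> \<times> \<Omega>')"
  shows "distr_entropy b (\<Omega> \<times> \<Omega>') q \<le>
    distr_entropy b \<Omega> (distr q (count_space \<Omega>) fst) + distr_entropy b \<Omega>' (distr q (count_space \<Omega>') snd)"
proof -
  define r where "r = distr q (count_space \<Omega>) fst"
  define s where "s = distr q (count_space \<Omega>') snd"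
  have fin': "finite (\<Omega> \<times> \<Omega>')" using fin by auto
  have "r \<in> distributions \<Omega>" "s \<in> distributions \<Omega>'"
    unfolding r_def s_def using q by (auto intro!: distr_in_distributions[where \<Omega> = "\<Omega> \<times> \<Omega>'"])
  note rs = pair_measure_in_distributions(1)[OF this fin]
  have one: "(\<Sum>z\<in>\<Omega> \<times> \<Omega>'. measure m {z}) = 1" if "m \<in> distributions (\<Omega> \<times> \<Omega>')" for m
    using distributions_measure_eq_sum[OF that fin' order_refl] distributionsD[OF that]
    by (metis prob_space.prob_space)
  have "(\<Sum>z\<in>\<Omega> \<times> \<Omega>'. measure q {z} * ln (measure (r \<Otimes>\<^sub>M s) {z})) \<le> neg_entropy (\<Omega> \<times> \<Omega>') (\<lambda>z. measure q {z})"
    using cross_entropy_marginals(2)[OF b fin q r_def s_def] one[OF q] one[OF rs]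
    by (intro gibbs_inequality) auto
  then have "(\<Sum>z\<in>\<Omega> \<times> \<Omega>'. measure q {z} * ln (measure (r \<Otimes>\<^sub>M s) {z})) / ln b \<le> - distr_entropy b (\<Omega> \<times> \<Omega>') q"
    using b by (simp add: distr_entropy_eq_neg_entropy[OF b fin' q] divide_right_mono)
  then show ?thesis
    unfolding cross_entropy_marginals(1)[OF b fin q r_def s_def] by (simp add: r_def s_def)
qed

section \<open>Maximal chains of the input lattice\<close>

lemma finite_input_lattice: "finite (input_lattice n)"
  by (rule finite_subset[of _ "Pow (Pow {1..n})"]) (auto simp: input_lattice_def simplicial_complex_def)

lemma finite_maximal_chains: "finite (maximal_chains n)"
  by (rule finite_subset[of _ "Pow (input_lattice n)"])
    (auto simp: maximal_chains_def finite_input_lattice subset.maxchain_def subset_chain_def)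

lemma maximal_chains_nonempty: "maximal_chains n \<noteq> {}"
  using subset.Hausdorff[of "input_lattice n"] by (auto simp: maximal_chains_def)

lemma maximal_chainD:
  assumes "C \<in> maximal_chains n"
  shows "C \<subseteq> input_lattice n" "finite C" "\<And>U V. U \<in> C \<Longrightarrow> V \<in> C \<Longrightarrow> U \<subseteq> V \<or> V \<subseteq> U"
proof -
  have "subset.chain (input_lattice n) C"
    using assms by (simp add: maximal_chains_def subset.maxchain_def)
  then show "C \<subseteq> input_lattice n" "\<And>U V. U \<in> C \<Longrightarrow> V \<in> C \<Longrightarrow> U \<subseteq> V \<or> V \<subseteq> U"
    by (auto simp: subset_chain_def)
  then show "finite C"
    using finite_subset[OF _ finite_input_lattice] by metis
qed

lemma maximal_chain_memI:
  assumes "C \<in> maximal_chains n" "W \<in> input_lattice n" "\<And>U. U \<in> C \<Longrightarrow> U \<subseteq> W \<or> W \<subseteq> U"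
  shows "W \<in> C"
proof (rule ccontr)
  assume "W \<notin> C"
  have "subset.chain (input_lattice n) (insert W C)"
    unfolding subset_chain_def using maximal_chainD[OF assms(1)] assms(2,3) by blast
  with \<open>W \<notin> C\<close> assms(1) show False
    unfolding maximal_chains_def subset.maxchain_def by blast
qed

lemma bot_in_input_lattice: "{{}} \<in> input_lattice n"
  by (auto simp: input_lattice_def simplicial_complex_def)

lemma top_in_input_lattice: "Pow {1..n} \<in> input_lattice n"
  by (auto simp: input_lattice_def simplicial_complex_def)

lemma input_lattice_bounds:
  assumes "U \<in> input_lattice n"
  shows "{{}} \<subseteq> U" "U \<subseteq> Pow {1..n}"
  using assms by (auto simp: input_lattice_def simplicial_complex_def)

lemma maximal_chain_bot_top:
  assumes "C \<in> maximal_chains n"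
  shows "{{}} \<in> C" "Pow {1..n} \<in> C"
proof -
  have "{{}} \<subseteq> U" "U \<subseteq> Pow {1..n}" if "U \<in> C" for U
    using input_lattice_bounds maximal_chainD(1)[OF assms] that by blast+
  then show "{{}} \<in> C" "Pow {1..n} \<in> C"
    using maximal_chain_memI[OF assms bot_in_input_lattice] maximal_chain_memI[OF assms top_in_input_lattice]
    by metis+
qed

text \<open>A member of \<open>V - U\<close> of least cardinality has all its proper subsets in
  \<open>U\<close>, so adding it to \<open>U\<close> gives a complex. That complex is comparable
  with the whole chain, hence belongs to it by maximality; lying above \<open>U\<close> and within
  \<open>V\<close>, it must be \<open>V\<close>.\<close>

lemma consecutive_in_edges:
  assumes C: "C \<in> maximal_chains n" and UV: "consecutive C U V"
  obtains B where "B \<in> Pow {1..n}" "(U, V) \<in> edges n B"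
proof -
  have L: "U \<in> input_lattice n" "V \<in> input_lattice n" and U: "U \<in> C" and V: "V \<in> C" and sub: "U \<subset> V"
    using maximal_chainD(1)[OF C] UV by (auto simp: consecutive_def)
  then obtain B0 where "B0 \<in> V - U" by auto
  then obtain B where B: "B \<in> V" "B \<notin> U" and min: "\<And>B'. B' \<in> V - U \<Longrightarrow> card B \<le> card B'"
    using ex_has_least_nat[of "\<lambda>B. B \<in> V - U" B0 card] by (metis DiffE)
  have Bn: "B \<subseteq> {1..n}"
    using B L by (auto simp: input_lattice_def simplicial_complex_def)
  then have finB: "finite B" by (rule finite_subset) simp
  have "B' \<in> insert B U" if "B' \<subseteq> B" for B'
  proof (cases "B' = B")
    case False
    with that finB have "card B' < card B" by (simp add: psubset_card_mono)
    moreover have "B' \<in> V"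
      using that B(1) L by (auto simp: input_lattice_def simplicial_complex_def)
    ultimately show ?thesis
      using min[of B'] by auto
  qed simp
  with L Bn have W: "insert B U \<in> input_lattice n"
    by (auto simp: input_lattice_def simplicial_complex_def)
  have "insert B U \<in> C"
  proof (rule maximal_chain_memI[OF C W])
    fix W assume "W \<in> C"
    then have "W \<subseteq> U \<or> V \<subseteq> W"
      using maximal_chainD(3)[OF C, of W U] maximal_chainD(3)[OF C, of W V] U V UV
      unfolding consecutive_def by blast
    then show "W \<subseteq> insert B U \<or> insert B U \<subseteq> W"
      using B sub by blast
  qed
  with UV B sub have "V = insert B U"
    unfolding consecutive_def by blast
  with that[of B] L B Bn show thesis
    by (auto simp: edges_def)
qed

text \<open>Every element except \<open>hi\<close> has exactly one successor and every element
  except \<open>lo\<close> exactly one predecessor. First components thus run once through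
  \<open>C - {hi}\<close> and second components once through \<open>C - {lo}\<close>.\<close>

lemma telescope_consecutive:
  fixes h :: "'a set \<Rightarrow> real"
  assumes "finite C" "\<And>U V. U \<in> C \<Longrightarrow> V \<in> C \<Longrightarrow> U \<subseteq> V \<or> V \<subseteq> U"
    and "lo \<in> C" "hi \<in> C" "\<And>U. U \<in> C \<Longrightarrow> lo \<subseteq> U" "\<And>U. U \<in> C \<Longrightarrow> U \<subseteq> hi"
  shows "(\<Sum>(U, V)\<in>{(U, V). consecutive C U V}. h U - h V) = h lo - h hi"
proof -
  let ?P = "{(U, V). consecutive C U V}"
  have uniq: "V = V'" if "consecutive C U V" "consecutive C U V'" for U V V'
    using that assms(2)[of V V'] unfolding consecutive_def by blast
  have uniq': "U = U'" if "consecutive C U V" "consecutive C U' V" for U U' V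
    using that assms(2)[of U U'] unfolding consecutive_def by blast
  have "\<exists>V. consecutive C U V" if "U \<in> C - {hi}" for U
  proof -
    let ?A = "{V\<in>C. U \<subset> V}"
    have "finite ?A"
      using assms(1) by simp
    moreover have "hi \<in> ?A"
      using assms(4,6) that by blast
    ultimately obtain V where "V \<in> ?A" "\<forall>W\<in>?A. W \<subseteq> V \<longrightarrow> V = W"
      using finite_has_minimal[of ?A] by blast
    then show ?thesis
      using that unfolding consecutive_def by blast
  qed
  then have dom: "fst ` ?P = C - {hi}"
  proof (intro equalityI subsetI)
    fix U assume "U \<in> fst ` ?P"
    then obtain V where "consecutive C U V" by auto
    then show "U \<in> C - {hi}"
      using assms(6)[of V] by (auto simp: consecutive_def)
  qed (auto simp: image_iff)
  have "\<exists>U. consecutive C U V" if "V \<in> C - {lo}" for V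
  proof -
    let ?A = "{U\<in>C. U \<subset> V}"
    have "finite ?A"
      using assms(1) by simp
    moreover have "lo \<in> ?A"
      using assms(3,5) that by blast
    ultimately obtain U where "U \<in> ?A" "\<forall>W\<in>?A. U \<subseteq> W \<longrightarrow> U = W"
      using finite_has_maximal[of ?A] by blast
    then show ?thesis
      using that unfolding consecutive_def by blast
  qed
  then have ran: "snd ` ?P = C - {lo}"
  proof (intro equalityI subsetI)
    fix V assume "V \<in> snd ` ?P"
    then obtain U where "consecutive C U V" by auto
    then show "V \<in> C - {lo}"
      using assms(5)[of U] by (auto simp: consecutive_def)
  qed (auto simp: image_iff)
  have "(\<Sum>(U, V)\<in>?P. h U - h V) = (\<Sum>e\<in>?P. h (fst e)) - (\<Sum>e\<in>?P. h (snd e))"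
    by (simp add: case_prod_unfold sum_subtractf)
  also have "(\<Sum>e\<in>?P. h (fst e)) = sum h (C - {hi})"
    unfolding dom[symmetric] using uniq by (subst sum.reindex) (auto simp: inj_on_def)
  also have "(\<Sum>e\<in>?P. h (snd e)) = sum h (C - {lo})"
    unfolding ran[symmetric] using uniq' by (subst sum.reindex) (auto simp: inj_on_def)
  finally show ?thesis
    using assms by (simp add: sum_diff1)
qed

lemma edges_subset: "edges n A \<subseteq> input_lattice n \<times> input_lattice n"
  by (auto simp: edges_def)

lemma finite_edges: "finite (edges n A)"
  using finite_input_lattice edges_subset by (meson finite_SigmaI finite_subset)

text \<open>Double counting: the weight of an edge is the number of chains through it, so after
  exchanging the sums each maximal chain contributes one telescoping sum.\<close>

lemma sum_edges_telescope:
  fixes h :: "nat set set \<Rightarrow> real"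
  shows "(\<Sum>B\<in>Pow {1..n}. \<Sum>(U, V)\<in>edges n B. real (num_chains_through n U V) * (h U - h V)) =
    real (card (maximal_chains n)) * (h {{}} - h (Pow {1..n}))"
proof -
  define E where "E = (\<Union>B\<in>Pow {1..n}. edges n B)"
  have finE: "finite E"
    unfolding E_def by (auto intro: finite_edges)
  \<comment> \<open>An edge determines the set that it adds.\<close>
  have "edges n B \<inter> edges n B' = {}" if "B \<noteq> B'" for B B'
    using that by (auto simp: edges_def)
  then have "(\<Sum>B\<in>Pow {1..n}. \<Sum>(U, V)\<in>edges n B. real (num_chains_through n U V) * (h U - h V)) =
      (\<Sum>(U, V)\<in>E. real (num_chains_through n U V) * (h U - h V))"
    unfolding E_def by (subst sum.UNION_disjoint) (auto intro: finite_edges)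
  also have "\<dots> = (\<Sum>e\<in>E. \<Sum>C\<in>maximal_chains n.
      if consecutive C (fst e) (snd e) then h (fst e) - h (snd e) else 0)"
    by (intro sum.cong) (auto simp: num_chains_through_def sum.If_cases finite_maximal_chains Int_def)
  also have "\<dots> = (\<Sum>C\<in>maximal_chains n. \<Sum>e\<in>E.
      if consecutive C (fst e) (snd e) then h (fst e) - h (snd e) else 0)"
    by (rule sum.swap)
  also have "\<dots> = (\<Sum>C\<in>maximal_chains n. h {{}} - h (Pow {1..n}))"
  proof (rule sum.cong)
    fix C assume C: "C \<in> maximal_chains n"
    have "(U, V) \<in> E" if UV: "consecutive C U V" for U V
    proof -
      obtain B where "B \<in> Pow {1..n}" "(U, V) \<in> edges n B"
        by (rule consecutive_in_edges[OF C UV])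
      then show ?thesis
        unfolding E_def by (rule UN_I)
    qed
    then have eq: "{e\<in>E. consecutive C (fst e) (snd e)} = {(U, V). consecutive C U V}"
      by auto
    have "(\<Sum>e\<in>E. if consecutive C (fst e) (snd e) then h (fst e) - h (snd e) else 0) =
        (\<Sum>e\<in>{e\<in>E. consecutive C (fst e) (snd e)}. h (fst e) - h (snd e))"
      using finE by (simp add: sum.inter_filter)
    also have "\<dots> = (\<Sum>(U, V)\<in>{(U, V). consecutive C U V}. h U - h V)"
      unfolding eq by (simp add: case_prod_unfold)
    also have "\<dots> = h {{}} - h (Pow {1..n})"
    proof (rule telescope_consecutive)
      show "{{}} \<subseteq> U" "U \<subseteq> Pow {1..n}" if "U \<in> C" for U
        using that maximal_chainD(1)[OF C] input_lattice_bounds by blast+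
    qed (use maximal_chainD[OF C] maximal_chain_bot_top[OF C] in auto)
    finally show "(\<Sum>e\<in>E. if consecutive C (fst e) (snd e) then h (fst e) - h (snd e) else 0) =
        h {{}} - h (Pow {1..n})" .
  qed simp
  finally show ?thesis by simp
qed

section \<open>Permutations of the inputs acting on complexes and chains\<close>

definition relabel :: "(nat \<Rightarrow> nat) \<Rightarrow> nat set set \<Rightarrow> nat set set" where
  "relabel \<tau> U = (\<lambda>B. \<tau> -` B) ` U"

context
  fixes \<tau> :: "nat \<Rightarrow> nat" and n :: nat
  assumes perm: "\<tau> permutes {1..n}"
begin

lemma inj_vimage_permutation: "inj (\<lambda>B. \<tau> -` B)"
proof (rule injI)
  fix A B assume "\<tau> -` A = \<tau> -` B"
  then have "\<tau> ` (\<tau> -` A) = \<tau> ` (\<tau> -` B)" by simp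
  then show "A = B"
    by (simp only: surj_image_vimage_eq[OF permutes_surj[OF perm]])
qed

lemma inj_relabel: "inj (relabel \<tau>)"
  unfolding relabel_def by (intro injI) (simp add: inj_image_eq_iff[OF inj_vimage_permutation])

lemma relabel_subset_iff: "relabel \<tau> U \<subseteq> relabel \<tau> V \<longleftrightarrow> U \<subseteq> V"
  using inj_vimage_permutation by (simp add: relabel_def inj_image_subset_iff)

lemma relabel_psubset_iff: "relabel \<tau> U \<subset> relabel \<tau> V \<longleftrightarrow> U \<subset> V"
  by (simp only: psubset_eq relabel_subset_iff inj_eq[OF inj_relabel])

lemma relabel_inv: "relabel \<tau> (relabel (inv \<tau>) U) = U"
  using permutes_inv_o[OF perm] by (simp add: relabel_def image_image vimage_comp)

text \<open>For closure under subsets: if \<open>B\<close> lies in the preimage of \<open>A\<close>,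
  then its image under \<open>\<tau>\<close> is a subset of \<open>A\<close>, and \<open>B\<close>
  is the preimage of that image by injectivity.\<close>

lemma relabel_in_input_lattice:
  assumes "U \<in> input_lattice n"
  shows "relabel \<tau> U \<in> input_lattice n"
proof -
  have U: "U \<noteq> {}" "U \<subseteq> Pow {1..n}" "\<And>A B. A \<in> U \<Longrightarrow> B \<subseteq> A \<Longrightarrow> B \<in> U"
    using assms by (auto simp: input_lattice_def simplicial_complex_def)
  have "B \<in> relabel \<tau> U" if "A \<in> U" "B \<subseteq> \<tau> -` A" for A B
  proof -
    have "\<tau> ` B \<in> U"
      using U(3)[OF that(1)] that(2) by blast
    then show ?thesis
      unfolding relabel_def using inj_vimage_image_eq[OF permutes_inj[OF perm]] by (metis image_eqI)
  qed
  moreover have "\<tau> -` A \<subseteq> {1..n}" if "A \<in> U" for A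
    using that U(2) permutes_in_image[OF perm] by blast
  ultimately show ?thesis
    using U(1) unfolding input_lattice_def simplicial_complex_def relabel_def mem_Collect_eq by blast
qed

end

lemma relabel_input_lattice:
  assumes "\<tau> permutes {1..n}"
  shows "relabel \<tau> ` input_lattice n = input_lattice n"
proof
  show "relabel \<tau> ` input_lattice n \<subseteq> input_lattice n"
    using relabel_in_input_lattice[OF assms] by blast
  show "input_lattice n \<subseteq> relabel \<tau> ` input_lattice n"
    using relabel_in_input_lattice[OF permutes_inv[OF assms]] relabel_inv[OF assms] by (metis image_eqI subsetI)
qed

lemma relabel_chain:
  assumes "\<tau> permutes {1..n}"
  shows "subset.chain (input_lattice n) (relabel \<tau> ` C) \<longleftrightarrow> subset.chain (input_lattice n) C"
proof -
  have "relabel \<tau> ` C \<subseteq> input_lattice n \<longleftrightarrow> C \<subseteq> input_lattice n"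
    using inj_image_subset_iff[OF inj_relabel[OF assms], of C "input_lattice n"]
    by (simp only: relabel_input_lattice[OF assms])
  then show ?thesis
    by (simp add: subset_chain_def relabel_subset_iff[OF assms])
qed

text \<open>Relabelling permutes the lattice, so any chain properly above a relabelled one is itself
  relabelled; extensions correspond on both sides.\<close>

lemma relabel_maximal_chains:
  assumes "\<tau> permutes {1..n}"
  shows "relabel \<tau> ` C \<in> maximal_chains n \<longleftrightarrow> C \<in> maximal_chains n"
proof -
  have "\<exists>D. D' = relabel \<tau> ` D" if "subset.chain (input_lattice n) D'" for D'
    using that relabel_input_lattice[OF assms] by (metis subset_chain_def subset_imageE)
  then have "(\<exists>D'. subset.chain (input_lattice n) D' \<and> relabel \<tau> ` C \<subset> D') \<longleftrightarrow>
      (\<exists>D. subset.chain (input_lattice n) D \<and> C \<subset> D)"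
    using relabel_chain[OF assms] inj_image_subset_iff[OF inj_relabel[OF assms]] by (metis psubset_eq subset_not_subset_eq)
  then show ?thesis
    by (simp only: maximal_chains_def subset.maxchain_def relabel_chain[OF assms] mem_Collect_eq)
qed

lemma relabel_consecutive:
  assumes "\<tau> permutes {1..n}"
  shows "consecutive (relabel \<tau> ` C) (relabel \<tau> U) (relabel \<tau> V) \<longleftrightarrow> consecutive C U V"
  by (simp add: consecutive_def relabel_psubset_iff[OF assms] inj_image_mem_iff[OF inj_relabel[OF assms]])

lemma relabel_num_chains_through:
  assumes "\<tau> permutes {1..n}"
  shows "num_chains_through n (relabel \<tau> U) (relabel \<tau> V) = num_chains_through n U V"
proof -
  have "{C \<in> maximal_chains n. consecutive C (relabel \<tau> U) (relabel \<tau> V)} =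
      (`) (relabel \<tau>) ` {C \<in> maximal_chains n. consecutive C U V}" (is "?l = ?r")
  proof
    show "?r \<subseteq> ?l"
      using relabel_maximal_chains[OF assms] relabel_consecutive[OF assms] by auto
    show "?l \<subseteq> ?r"
    proof
      fix C assume C: "C \<in> ?l"
      have "C = relabel \<tau> ` relabel (inv \<tau>) ` C"
        by (simp add: image_image relabel_inv[OF assms])
      moreover from this C have "relabel (inv \<tau>) ` C \<in> {C \<in> maximal_chains n. consecutive C U V}"
        using relabel_maximal_chains[OF assms] relabel_consecutive[OF assms] by (metis (lifting) mem_Collect_eq)
      ultimately show "C \<in> ?r"
        by (rule image_eqI)
    qed
  qed
  moreover have "inj ((`) (relabel \<tau>))"
    using inj_relabel[OF assms] by (simp add: inj_def inj_image_eq_iff)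
  ultimately show ?thesis
    unfolding num_chains_through_def using card_image[OF inj_on_subset[OF _ subset_UNIV]] by simp
qed

text \<open>Position \<open>i\<close> of the permuted tuple holds input \<open>\<tau> i\<close>, so
  a set of inputs is addressed there by its preimage under \<open>\<tau>\<close>; this is why
  \<open>relabel\<close> takes preimages.\<close>

lemma relabel_edges:
  assumes "\<tau> permutes {1..n}"
  shows "edges n (\<tau> -` A) = (\<lambda>(U, V). (relabel \<tau> U, relabel \<tau> V)) ` edges n A"
proof -
  have mem: "\<tau> -` A \<in> relabel \<tau> U \<longleftrightarrow> A \<in> U" for U
    unfolding relabel_def by (rule inj_image_mem_iff[OF inj_vimage_permutation[OF assms]])
  have ins: "relabel \<tau> (insert A U) = insert (\<tau> -` A) (relabel \<tau> U)" for U
    unfolding relabel_def by (rule image_insert)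
  show ?thesis
  proof (intro equalityI subsetI)
    fix e assume e: "e \<in> edges n (\<tau> -` A)"
    then obtain U where U: "e = (U, insert (\<tau> -` A) U)" "U \<in> input_lattice n"
      "insert (\<tau> -` A) U \<in> input_lattice n" "\<tau> -` A \<notin> U"
      by (auto simp: edges_def)
    then obtain U' where U': "U = relabel \<tau> U'" "U' \<in> input_lattice n"
      using relabel_input_lattice[OF assms] by blast
    have "insert A U' \<in> input_lattice n"
      using U(3) inj_image_mem_iff[OF inj_relabel[OF assms], of "insert A U'" "input_lattice n"]
      by (simp add: U' ins relabel_input_lattice[OF assms])
    then have "(U', insert A U') \<in> edges n A"
      using U U' by (simp add: edges_def mem)
    then show "e \<in> (\<lambda>(U, V). (relabel \<tau> U, relabel \<tau> V)) ` edges n A"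
      using U(1) U'(1) by (auto simp: ins intro!: image_eqI[of _ _ "(U', insert A U')"])
  next
    fix e assume "e \<in> (\<lambda>(U, V). (relabel \<tau> U, relabel \<tau> V)) ` edges n A"
    then obtain U where U: "e = (relabel \<tau> U, relabel \<tau> (insert A U))" "U \<in> input_lattice n"
      "insert A U \<in> input_lattice n" "A \<notin> U"
      by (auto simp: edges_def)
    show "e \<in> edges n (\<tau> -` A)"
      using relabel_in_input_lattice[OF assms U(2)] relabel_in_input_lattice[OF assms U(3)] U(4)
      unfolding U(1) edges_def by (simp add: mem ins)
  qed
qed

section \<open>Entropy of split distributions\<close>

lemma distr_distr_distributions:
  assumes "q \<in> distributions \<Omega>" "g \<in> \<Omega> \<rightarrow> \<Omega>'" "h \<in> \<Omega>' \<rightarrow> \<Omega>''"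
  shows "distr (distr q (count_space \<Omega>') g) (count_space \<Omega>'') h = distr q (count_space \<Omega>'') (\<lambda>z. h (g z))"
  using distr_distr[OF _ distributions_measurable[OF assms(1,2)], of h "count_space \<Omega>''"] assms(3)
  by (simp add: comp_def)

lemma distr_cong_distributions:
  assumes "q \<in> distributions \<Omega>" "\<And>z. z \<in> \<Omega> \<Longrightarrow> g z = h z"
  shows "distr q N g = distr q N h"
  using assms distributionsD(3)[OF assms(1)] by (intro distr_cong) auto

text \<open>Agreement of two distributions on a marginal passes to every function of that marginal.
  This is the means by which constraints are transferred throughout.\<close>

lemma distr_eq_factor:
  assumes "distr q (count_space \<Omega>') g = distr p (count_space \<Omega>') g"
    and "q \<in> distributions \<Omega>" "p \<in> distributions \<Omega>" "g \<in> \<Omega> \<rightarrow> \<Omega>'" "h \<in> \<Omega>' \<rightarrow> \<Omega>''"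
    and "\<And>z. z \<in> \<Omega> \<Longrightarrow> k z = h (g z)"
  shows "distr q (count_space \<Omega>'') k = distr p (count_space \<Omega>'') k"
proof -
  have "distr m (count_space \<Omega>'') k = distr (distr m (count_space \<Omega>') g) (count_space \<Omega>'') h"
    if "m \<in> distributions \<Omega>" for m
    using distr_distr_distributions[OF that assms(4,5)] distr_cong_distributions[OF that assms(6)] by simp
  then show ?thesis
    using assms(1-3) by simp
qed

lemma finite_joint_states:
  assumes "\<And>i. i \<in> {1..n} \<Longrightarrow> finite (S i)" "finite T"
  shows "finite (joint_states n S T)"
  using assms by (auto simp: states_def intro!: finite_PiE)

lemma restrict_in_states:
  assumes "A \<subseteq> {1..n}" "z \<in> joint_states n S T"
  shows "(restrict (fst z) A, snd z) \<in> states S A \<times> T"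
  using assms by (auto simp: states_def PiE_iff)

lemma subset_marginal_eq:
  "subset_marginal S T A q = distr q (count_space (states S A \<times> T)) (\<lambda>z. (restrict (fst z) A, snd z))"
  by (simp add: subset_marginal_def case_prod_unfold)

text \<open>The fibres of all constrained marginal maps: fixing their probabilities amounts to
  fixing the marginals.\<close>

definition marginal_events :: "nat \<Rightarrow> (nat \<Rightarrow> 'a set) \<Rightarrow> 'y set \<Rightarrow> nat set set \<Rightarrow> ((nat \<Rightarrow> 'a) \<times> 'y) set set" where
  "marginal_events n S T U =
     (\<lambda>x. {z \<in> joint_states n S T. fst z = x}) ` states S {1..n} \<union>
     (\<Union>A\<in>U. (\<lambda>w. {z \<in> joint_states n S T. (restrict (fst z) A, snd z) = w}) ` (states S A \<times> T))"

lemma marginal_events_subset: "marginal_events n S T U \<subseteq> Pow (joint_states n S T)"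
  by (auto simp: marginal_events_def)

lemma split_family_eq_event_family:
  assumes fin: "\<And>i. i \<in> {1..n} \<Longrightarrow> finite (S i)" "finite T"
    and p: "p \<in> distributions (joint_states n S T)" and U: "U \<subseteq> Pow {1..n}"
  shows "split_family n S T p U = event_family (joint_states n S T) (marginal_events n S T U) p"
proof -
  let ?\<Omega> = "joint_states n S T"
  have "finite (states S {1..n})"
    unfolding states_def using fin(1) by (intro finite_PiE) auto
  then have input: "input_marginal n S q = input_marginal n S p \<longleftrightarrow>
      (\<forall>x\<in>states S {1..n}. measure q {z\<in>?\<Omega>. fst z = x} = measure p {z\<in>?\<Omega>. fst z = x})"
    if "q \<in> distributions ?\<Omega>" for q
    unfolding input_marginal_def using that p by (intro distr_eq_iff_measure_fibres) auto
  have subset: "subset_marginal S T A q = subset_marginal S T A p \<longleftrightarrow>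
      (\<forall>w\<in>states S A \<times> T. measure q {z\<in>?\<Omega>. (restrict (fst z) A, snd z) = w} =
        measure p {z\<in>?\<Omega>. (restrict (fst z) A, snd z) = w})"
    if "q \<in> distributions ?\<Omega>" "A \<in> U" for q A
  proof -
    have A: "A \<subseteq> {1..n}" using that U by auto
    then have "finite (states S A \<times> T)"
      unfolding states_def using fin by (intro finite_cartesian_product finite_PiE) (auto intro: finite_subset)
    moreover have "(\<lambda>z. (restrict (fst z) A, snd z)) \<in> ?\<Omega> \<rightarrow> states S A \<times> T"
      by (intro Pi_I restrict_in_states[OF A])
    ultimately show ?thesis
      unfolding subset_marginal_eq by (intro distr_eq_iff_measure_fibres that(1) p)
  qed
  show ?thesis
    unfolding split_family_def event_family_def marginal_events_def ball_Un ball_UN ball_simps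
    using input subset by (intro Collect_cong conj_cong refl ball_cong) auto
qed

definition split_entropy ::
  "real \<Rightarrow> nat \<Rightarrow> (nat \<Rightarrow> 'a set) \<Rightarrow> 'y set \<Rightarrow> ((nat \<Rightarrow> 'a) \<times> 'y) measure \<Rightarrow> nat set set \<Rightarrow> real" where
  "split_entropy b n S T p U = distr_entropy b (joint_states n S T) (split_distr b n S T p U)"

text \<open>The distribution \<open>p\<close> is arbitrary rather than the law of given variables,
  so that images under relabelling and products are covered directly.\<close>

locale finite_joint =
  fixes b :: real and n :: nat and S :: "nat \<Rightarrow> 'a set" and T :: "'y set"
    and p :: "((nat \<Rightarrow> 'a) \<times> 'y) measure"
  assumes b: "1 < b"
    and finite_S: "\<And>i. i \<in> {1..n} \<Longrightarrow> finite (S i)" and finite_T: "finite T"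
    and p: "p \<in> distributions (joint_states n S T)"
begin

lemma finite_joint: "finite (joint_states n S T)"
  using finite_S finite_T by (rule finite_joint_states)

lemma finite_states: "finite (states S {1..n})"
  unfolding states_def using finite_S by (intro finite_PiE) auto

lemma split_family_eq:
  assumes "U \<subseteq> Pow {1..n}"
  shows "split_family n S T p U = event_family (joint_states n S T) (marginal_events n S T U) p"
  using assms p finite_S finite_T by (intro split_family_eq_event_family)

lemma split_distr_is_arg_max:
  assumes "U \<subseteq> Pow {1..n}"
  shows "is_arg_max (distr_entropy b (joint_states n S T)) (\<lambda>q. q \<in> split_family n S T p U)
    (split_distr b n S T p U)"
  using someI_ex[OF event_family_entropy_maximizer[OF b finite_joint marginal_events_subset[of n S T U] p]]
  unfolding split_distr_def arg_max_on_def arg_max_def split_family_eq[OF assms] .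

lemma entropy_le_split_entropy:
  assumes "U \<subseteq> Pow {1..n}" "q \<in> split_family n S T p U"
  shows "distr_entropy b (joint_states n S T) q \<le> split_entropy b n S T p U"
  using split_distr_is_arg_max[OF assms(1)] assms(2) by (auto simp: is_arg_max_linorder split_entropy_def)

lemma split_distr_in_split_family:
  assumes "U \<subseteq> Pow {1..n}"
  shows "split_distr b n S T p U \<in> split_family n S T p U"
  using split_distr_is_arg_max[OF assms] by (simp add: is_arg_max_def)

lemma split_entropy_antimono:
  assumes "U \<subseteq> V" "V \<subseteq> Pow {1..n}"
  shows "split_entropy b n S T p V \<le> split_entropy b n S T p U"
proof -
  have "split_distr b n S T p V \<in> split_family n S T p U"
    using split_distr_in_split_family[OF assms(2)] assms(1) by (auto simp: split_family_def)
  then show ?thesis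
    using entropy_le_split_entropy[of U] assms by (auto simp: split_entropy_def)
qed

text \<open>The split distribution of the larger complex satisfies the constraints of the smaller
  one, so it is a competitor there and the entropy difference formula applies.\<close>

lemma kl_split_distr:
  assumes "U \<subseteq> V" "V \<subseteq> Pow {1..n}"
  shows "kl b (split_distr b n S T p V) (split_distr b n S T p U) =
    split_entropy b n S T p U - split_entropy b n S T p V"
proof -
  have U: "U \<subseteq> Pow {1..n}" using assms by auto
  have "split_distr b n S T p V \<in> split_family n S T p U"
    using split_distr_in_split_family[OF assms(2)] assms(1) by (auto simp: split_family_def)
  then show ?thesis
    using split_distr_is_arg_max[OF U] unfolding split_entropy_def
    by (intro kl_entropy_maximizer[OF b finite_joint marginal_events_subset])
      (simp_all add: split_family_eq[OF U])
qed

text \<open>The constraint for the full index set fixes the whole distribution, since restricting an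
  extensional tuple to its own index set changes nothing.\<close>

lemma split_entropy_top: "split_entropy b n S T p (Pow {1..n}) = distr_entropy b (joint_states n S T) p"
proof -
  have id: "subset_marginal S T {1..n} q = q" if q: "q \<in> distributions (joint_states n S T)" for q
  proof -
    have "subset_marginal S T {1..n} q = distr q (count_space (joint_states n S T)) (\<lambda>z. z)"
      unfolding subset_marginal_eq
      by (rule distr_cong_distributions[OF q]) (auto simp: states_def PiE_restrict)
    also have "\<dots> = q"
      by (rule distr_id2) (simp add: distributionsD[OF q])
    finally show ?thesis .
  qed
  let ?q = "split_distr b n S T p (Pow {1..n})"
  have "?q \<in> split_family n S T p (Pow {1..n})"
    by (rule split_distr_in_split_family) simp
  then have "?q \<in> distributions (joint_states n S T)" "subset_marginal S T {1..n} ?q = subset_marginal S T {1..n} p"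
    by (auto simp: split_family_def)
  then have "?q = p"
    using id p by simp
  then show ?thesis
    by (simp add: split_entropy_def)
qed

text \<open>At the bottom the constraints fix just the laws of the input tuple and of the output.
  Their entropies bound the joint entropy by subadditivity, and the product attains the
  bound.\<close>

lemma independent_coupling_maximizes:
  defines "r \<equiv> distr p (count_space (states S {1..n})) fst \<Otimes>\<^sub>M distr p (count_space T) snd"
  shows "r \<in> split_family n S T p {{}}"
    and "\<And>q. q \<in> split_family n S T p {{}} \<Longrightarrow>
      distr_entropy b (joint_states n S T) q \<le> distr_entropy b (joint_states n S T) r"
proof -
  let ?pX = "distr p (count_space (states S {1..n})) fst" and ?pY = "distr p (count_space T) snd"
  have fs: "fst \<in> joint_states n S T \<rightarrow> states S {1..n}" "snd \<in> joint_states n S T \<rightarrow> T"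
    by auto
  have XY: "?pX \<in> distributions (states S {1..n})" "?pY \<in> distributions T"
    using distr_in_distributions[OF p fs(1)] distr_in_distributions[OF p fs(2)] .
  have r: "r \<in> distributions (joint_states n S T)"
    unfolding r_def using pair_measure_in_distributions(1)[OF XY finite_states finite_T] .
  have "distr r (count_space T) snd = distr p (count_space T) snd"
    unfolding r_def by (rule marginals_pair_measure(2)[OF XY])
  \<comment> \<open>The restriction of a tuple to the empty set is the constant
    \<open>undefined\<close>, so this marginal is the law of the output paired with a fixed
    dummy.\<close>
  then have "subset_marginal S T {} r = subset_marginal S T {} p"
    unfolding subset_marginal_eq
    by (rule distr_eq_factor[OF _ r p fs(2), where h = "\<lambda>y. (\<lambda>_. undefined, y)"]) (auto simp: states_def)
  moreover have "input_marginal n S r = input_marginal n S p"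
    unfolding input_marginal_def r_def by (rule marginals_pair_measure(1)[OF XY])
  ultimately show "r \<in> split_family n S T p {{}}"
    using r by (simp add: split_family_def)
  fix q assume "q \<in> split_family n S T p {{}}"
  then have q: "q \<in> distributions (joint_states n S T)" "input_marginal n S q = input_marginal n S p"
    "subset_marginal S T {} q = subset_marginal S T {} p"
    by (auto simp: split_family_def)
  have "distr q (count_space T) snd = distr p (count_space T) snd"
    by (rule distr_eq_factor[OF q(3)[unfolded subset_marginal_eq] q(1) p, where h = snd])
      (auto simp: states_def)
  with q have "distr_entropy b (joint_states n S T) q \<le>
      distr_entropy b (states S {1..n}) ?pX + distr_entropy b T ?pY"
    using distr_entropy_le_marginals[OF b finite_states finite_T q(1)] by (simp add: input_marginal_def)
  also have "\<dots> = distr_entropy b (joint_states n S T) r"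
    unfolding r_def by (rule distr_entropy_pair_measure[OF b finite_states finite_T XY, symmetric])
  finally show "distr_entropy b (joint_states n S T) q \<le> distr_entropy b (joint_states n S T) r" .
qed

lemma kl_independent_coupling:
  "kl b p (distr p (count_space (states S {1..n})) fst \<Otimes>\<^sub>M distr p (count_space T) snd) =
     split_entropy b n S T p {{}} - split_entropy b n S T p (Pow {1..n})" (is "kl b p ?r = _")
proof -
  let ?H = "distr_entropy b (joint_states n S T)"
  have U: "{{}} \<subseteq> Pow {1..n}" by simp
  have p': "p \<in> split_family n S T p {{}}"
    using p by (simp add: split_family_def)
  have max: "is_arg_max ?H (\<lambda>q. q \<in> split_family n S T p {{}}) ?r"
    using independent_coupling_maximizes by (auto simp: is_arg_max_linorder)
  \<comment> \<open>The chosen split distribution and the explicit product both maximise, so their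
    entropies agree.\<close>
  have "split_entropy b n S T p {{}} = ?H ?r"
    using max split_distr_is_arg_max[OF U] unfolding split_entropy_def is_arg_max_linorder
    by (meson antisym)
  moreover have "kl b p ?r = ?H ?r - ?H p"
    using max p' unfolding split_family_eq[OF U]
    by (intro kl_entropy_maximizer[OF b finite_joint marginal_events_subset])
  ultimately show ?thesis
    by (simp only: split_entropy_top)
qed

end

text \<open>Transport of competitors along a map of joint states. Each constraint on the image must
  be a function of some constraint on the source; this covers both permuted inputs and the
  projection of pairs to a component.\<close>

lemma split_family_distr:
  assumes p: "p \<in> distributions (joint_states n S T)" and q: "q \<in> split_family n S T p U"
    and U: "U \<subseteq> Pow {1..n}" and V: "V \<subseteq> Pow {1..n}"
    and \<phi>: "\<phi> \<in> joint_states n S T \<rightarrow> joint_states n S' T'"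
    and inputs: "h \<in> states S {1..n} \<rightarrow> states S' {1..n}"
      "\<And>z. z \<in> joint_states n S T \<Longrightarrow> fst (\<phi> z) = h (fst z)"
    and subsets: "\<And>B. B \<in> V \<Longrightarrow> \<exists>A\<in>U. \<exists>g\<in>states S A \<times> T \<rightarrow> states S' B \<times> T'.
      \<forall>z\<in>joint_states n S T. (restrict (fst (\<phi> z)) B, snd (\<phi> z)) = g (restrict (fst z) A, snd z)"
  shows "distr q (count_space (joint_states n S' T')) \<phi> \<in>
    split_family n S' T' (distr p (count_space (joint_states n S' T')) \<phi>) V"
proof -
  let ?\<Omega> = "joint_states n S T" and ?\<Omega>' = "joint_states n S' T'"
  have q': "q \<in> distributions ?\<Omega>" "input_marginal n S q = input_marginal n S p"
    "\<And>A. A \<in> U \<Longrightarrow> subset_marginal S T A q = subset_marginal S T A p"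
    using q by (auto simp: split_family_def)
  have "distr q (count_space (states S' {1..n})) (\<lambda>z. fst (\<phi> z)) =
      distr p (count_space (states S' {1..n})) (\<lambda>z. fst (\<phi> z))"
    using inputs(2) by (intro distr_eq_factor[OF q'(2)[unfolded input_marginal_def] q'(1) p _ inputs(1)]) auto
  moreover have "fst \<in> ?\<Omega>' \<rightarrow> states S' {1..n}" by auto
  ultimately have "input_marginal n S' (distr q (count_space ?\<Omega>') \<phi>) = input_marginal n S' (distr p (count_space ?\<Omega>') \<phi>)"
    unfolding input_marginal_def
    by (simp only: distr_distr_distributions[OF q'(1) \<phi>] distr_distr_distributions[OF p \<phi>])
  moreover have "subset_marginal S' T' B (distr q (count_space ?\<Omega>') \<phi>) = subset_marginal S' T' B (distr p (count_space ?\<Omega>') \<phi>)"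
    if B: "B \<in> V" for B
  proof -
    obtain A g where A: "A \<in> U" "g \<in> states S A \<times> T \<rightarrow> states S' B \<times> T'"
      and g: "\<And>z. z \<in> ?\<Omega> \<Longrightarrow> (restrict (fst (\<phi> z)) B, snd (\<phi> z)) = g (restrict (fst z) A, snd z)"
      using subsets[OF B] by blast
    have r: "(\<lambda>z. (restrict (fst z) A, snd z)) \<in> ?\<Omega> \<rightarrow> states S A \<times> T"
      using A U by (intro Pi_I restrict_in_states) auto
    have r': "(\<lambda>z. (restrict (fst z) B, snd z)) \<in> ?\<Omega>' \<rightarrow> states S' B \<times> T'"
      using B V by (intro Pi_I restrict_in_states) auto
    show ?thesis
      using distr_eq_factor[OF q'(3)[OF A(1), unfolded subset_marginal_eq] q'(1) p r A(2) g]
      unfolding subset_marginal_eq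
      by (simp only: distr_distr_distributions[OF q'(1) \<phi> r'] distr_distr_distributions[OF p \<phi> r'])
  qed
  ultimately show ?thesis
    using distr_in_distributions[OF q'(1) \<phi>] by (simp add: split_family_def)
qed

section \<open>Information contributions\<close>

lemma tuple_measurable:
  assumes "finite_rvs n M S T X Y"
  shows "tuple n X \<in> M \<rightarrow>\<^sub>M count_space (states S {1..n})"
proof -
  have X: "X i \<in> M \<rightarrow>\<^sub>M count_space (S i)" "finite (S i)" if "i \<in> {1..n}" for i
    using assms that by (auto simp: finite_rvs_def)
  then have range: "tuple n X \<in> space M \<rightarrow> states S {1..n}"
    using measurable_space[OF X(1)] by (auto simp: tuple_def states_def)
  have "finite (states S {1..n})"
    unfolding states_def using X by (intro finite_PiE) auto
  moreover have "tuple n X -` {x} \<inter> space M \<in> sets M" if x: "x \<in> states S {1..n}" for x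
  proof -
    have "{\<omega> \<in> space M. X i \<omega> = x i} \<in> sets M" if i: "i \<in> {1..n}" for i
    proof -
      have "x i \<in> S i"
        using x i by (auto simp: states_def)
      then have "X i -` {x i} \<inter> space M \<in> sets M"
        using measurable_sets[OF X(1)[OF i], of "{x i}"] by simp
      then show ?thesis
        by (simp add: vimage_def Int_def conj_commute)
    qed
    then have "{\<omega> \<in> space M. \<forall>i\<in>{1..n}. X i \<omega> = x i} \<in> sets M"
      by (intro sets.sets_Collect_finite_All) auto
    also have "{\<omega> \<in> space M. \<forall>i\<in>{1..n}. X i \<omega> = x i} = tuple n X -` {x} \<inter> space M"
      using x by (auto simp: tuple_def states_def PiE_iff extensional_def fun_eq_iff)
    finally show ?thesis .
  qed
  ultimately show ?thesis
    using range by (simp add: measurable_count_space_eq2)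
qed

lemma joint_measurable:
  assumes "finite_rvs n M S T X Y"
  shows "(\<lambda>\<omega>. (tuple n X \<omega>, Y \<omega>)) \<in> M \<rightarrow>\<^sub>M count_space (joint_states n S T)"
proof -
  have fin: "finite (states S {1..n})" "finite T"
    using assms unfolding states_def finite_rvs_def by (auto intro!: finite_PiE)
  have "(\<lambda>\<omega>. (tuple n X \<omega>, Y \<omega>)) \<in> M \<rightarrow>\<^sub>M count_space (states S {1..n}) \<Otimes>\<^sub>M count_space T"
    using tuple_measurable[OF assms] assms by (intro measurable_Pair) (auto simp: finite_rvs_def)
  then show ?thesis
    by (simp only: pair_measure_count_space[OF fin])
qed

lemma joint_distr_in_distributions:
  assumes "finite_rvs n M S T X Y"
  shows "joint_distr n M S T X Y \<in> distributions (joint_states n S T)"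
proof -
  interpret prob_space M using assms by (simp add: finite_rvs_def)
  show ?thesis
    using prob_space_distr[OF joint_measurable[OF assms]] by (simp add: joint_distr_def space_prob_algebra)
qed

lemma distr_joint_distr:
  assumes "finite_rvs n M S T X Y" "g \<in> joint_states n S T \<rightarrow> \<Omega>"
  shows "distr (joint_distr n M S T X Y) (count_space \<Omega>) g = distr M (count_space \<Omega>) (\<lambda>\<omega>. g (tuple n X \<omega>, Y \<omega>))"
  unfolding joint_distr_def using distr_distr[OF _ joint_measurable[OF assms(1)], of g "count_space \<Omega>"] assms(2)
  by (simp add: comp_def)

lemma finite_joint_joint_distr:
  assumes "finite_rvs n M S T X Y" "1 < b"
  shows "finite_joint b n S T (joint_distr n M S T X Y)"
  using assms joint_distr_in_distributions[OF assms(1)] by (auto simp: finite_joint_def finite_rvs_def)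

lemma edges_bounds:
  assumes "(U, V) \<in> edges n A"
  shows "U \<in> input_lattice n" "U \<subseteq> V" "V \<subseteq> Pow {1..n}"
proof -
  have "U \<in> input_lattice n" "V \<in> input_lattice n" "V = insert A U"
    using assms by (auto simp: edges_def)
  then show "U \<in> input_lattice n" "U \<subseteq> V" "V \<subseteq> Pow {1..n}"
    using input_lattice_bounds(2)[of V n] by blast+
qed

lemma info_contribution_eq:
  assumes "finite_rvs n M S T X Y" "1 < b"
  defines "h \<equiv> split_entropy b n S T (joint_distr n M S T X Y)"
  shows "info_contribution b n M S T X Y A =
    1 / real (card (maximal_chains n)) *
    (\<Sum>(U, V)\<in>edges n A. real (num_chains_through n U V) * (h U - h V))"
proof -
  interpret finite_joint b n S T "joint_distr n M S T X Y"
    using assms(1,2) by (rule finite_joint_joint_distr)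
  have "kl b (split_distr b n S T (joint_distr n M S T X Y) V) (split_distr b n S T (joint_distr n M S T X Y) U) = h U - h V"
    if "(U, V) \<in> edges n A" for U V
    unfolding h_def using edges_bounds[OF that] by (intro kl_split_distr)
  then show ?thesis
    unfolding info_contribution_def Let_def by (intro arg_cong2[where f = "(*)"] sum.cong) auto
qed

lemma info_contribution_nonneg:
  assumes "finite_rvs n M S T X Y" "1 < b"
  shows "0 \<le> info_contribution b n M S T X Y A"
proof -
  interpret finite_joint b n S T "joint_distr n M S T X Y"
    using assms by (rule finite_joint_joint_distr)
  have "0 \<le> split_entropy b n S T (joint_distr n M S T X Y) U - split_entropy b n S T (joint_distr n M S T X Y) V"
    if "(U, V) \<in> edges n A" for U V
    using split_entropy_antimono edges_bounds[OF that] by simp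
  then show ?thesis
    unfolding info_contribution_eq[OF assms] by (intro mult_nonneg_nonneg sum_nonneg) auto
qed

lemma sum_info_contribution:
  assumes "finite_rvs n M S T X Y" "1 < b"
  shows "(\<Sum>B\<in>Pow {1..n}. info_contribution b n M S T X Y B) = input_output_information b n M S T X Y"
proof -
  let ?p = "joint_distr n M S T X Y"
  interpret M: prob_space M using assms(1) by (simp add: finite_rvs_def)
  interpret finite_joint b n S T ?p
    using assms by (rule finite_joint_joint_distr)
  let ?h = "split_entropy b n S T ?p"
  \<comment> \<open>Required to cancel the normalising factor against the number of chains that the
    telescoping sum produces.\<close>
  have "card (maximal_chains n) \<noteq> 0"
    using finite_maximal_chains maximal_chains_nonempty by simp
  then have "(\<Sum>B\<in>Pow {1..n}. info_contribution b n M S T X Y B) = ?h {{}} - ?h (Pow {1..n})"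
    unfolding info_contribution_eq[OF assms] sum_distrib_left[symmetric] sum_edges_telescope by simp
  \<comment> \<open>Mutual information is by definition the divergence of the joint law from the
    product of the two laws, which are recovered here as marginals of \<open>?p\<close>.\<close>
  also have "\<dots> = kl b ?p (distr ?p (count_space (states S {1..n})) fst \<Otimes>\<^sub>M distr ?p (count_space T) snd)"
    by (rule kl_independent_coupling[symmetric])
  also have "distr ?p (count_space (states S {1..n})) fst = distr M (count_space (states S {1..n})) (tuple n X)"
    by (subst distr_joint_distr[OF assms(1)]) auto
  also have "distr ?p (count_space T) snd = distr M (count_space T) Y"
    by (subst distr_joint_distr[OF assms(1)]) auto
  finally show ?thesis
    unfolding input_output_information_def M.mutual_information_def kl_def
      pair_measure_count_space[OF finite_states finite_T] by (simp only: joint_distr_def)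
qed

section \<open>Permuting the inputs\<close>

definition permute_inputs :: "nat \<Rightarrow> (nat \<Rightarrow> nat) \<Rightarrow> (nat \<Rightarrow> 'a) \<times> 'y \<Rightarrow> (nat \<Rightarrow> 'a) \<times> 'y" where
  "permute_inputs n \<tau> z = (\<lambda>i\<in>{1..n}. fst z (\<tau> i), snd z)"

lemma permute_inputs_in_joint_states:
  assumes "\<tau> permutes {1..n}"
  shows "permute_inputs n \<tau> \<in> joint_states n S T \<rightarrow> joint_states n (\<lambda>i. S (\<tau> i)) T"
proof (rule Pi_I)
  fix z assume "z \<in> joint_states n S T"
  then have "fst z j \<in> S j" if "j \<in> {1..n}" for j
    using that by (auto simp: states_def PiE_iff)
  then have "fst z (\<tau> i) \<in> S (\<tau> i)" if "i \<in> {1..n}" for i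
    using that permutes_in_image[OF assms] by blast
  then show "permute_inputs n \<tau> z \<in> joint_states n (\<lambda>i. S (\<tau> i)) T"
    using \<open>z \<in> joint_states n S T\<close> by (auto simp: permute_inputs_def states_def)
qed

lemma permute_inputs_compose:
  assumes "\<tau> permutes {1..n}" "z \<in> joint_states n S T"
  shows "permute_inputs n (inv \<tau>) (permute_inputs n \<tau> z) = z"
proof -
  have "fst (permute_inputs n (inv \<tau>) (permute_inputs n \<tau> z)) i = fst z i" for i
  proof (cases "i \<in> {1..n}")
    case True
    then have "inv \<tau> i \<in> {1..n}"
      using permutes_in_image[OF permutes_inv[OF assms(1)]] by blast
    then show ?thesis
      using True permutes_inverses(1)[OF assms(1)] by (simp add: permute_inputs_def)
  next
    case False
    then show ?thesis
      using assms(2) by (auto simp: permute_inputs_def states_def PiE_iff extensional_def)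
  qed
  then show ?thesis
    by (auto simp: permute_inputs_def intro!: prod_eqI)
qed

lemma bij_betw_permute_inputs:
  assumes "\<tau> permutes {1..n}"
  shows "bij_betw (permute_inputs n \<tau>) (joint_states n S T) (joint_states n (\<lambda>i. S (\<tau> i)) T)"
proof (rule bij_betw_byWitness[where f' = "permute_inputs n (inv \<tau>)"])
  have inv: "inv (inv \<tau>) = \<tau>"
    by (rule inv_inv_eq[OF permutes_bij[OF assms]])
  have S: "(\<lambda>i. S (\<tau> (inv \<tau> i))) = S"
    using permutes_inverses(1)[OF assms] by simp
  show "\<forall>z\<in>joint_states n S T. permute_inputs n (inv \<tau>) (permute_inputs n \<tau> z) = z"
    using permute_inputs_compose[OF assms] by blast
  show "\<forall>z\<in>joint_states n (\<lambda>i. S (\<tau> i)) T. permute_inputs n \<tau> (permute_inputs n (inv \<tau>) z) = z"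
    using permute_inputs_compose[OF permutes_inv[OF assms]] unfolding inv by blast
  show "permute_inputs n \<tau> ` joint_states n S T \<subseteq> joint_states n (\<lambda>i. S (\<tau> i)) T"
    using permute_inputs_in_joint_states[OF assms] by blast
  show "permute_inputs n (inv \<tau>) ` joint_states n (\<lambda>i. S (\<tau> i)) T \<subseteq> joint_states n S T"
    using permute_inputs_in_joint_states[OF permutes_inv[OF assms], of "\<lambda>i. S (\<tau> i)"] unfolding S by blast
qed

text \<open>The permuted maximiser satisfies the relabelled constraints and keeps its entropy, being
  a bijective image. This is one inequality; the inverse permutation provides the other.\<close>

lemma split_entropy_permute_le:
  assumes "finite_joint b n S T p" and \<tau>: "\<tau> permutes {1..n}" and U: "U \<subseteq> Pow {1..n}"
  defines "p' \<equiv> distr p (count_space (joint_states n (\<lambda>i. S (\<tau> i)) T)) (permute_inputs n \<tau>)"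
  shows "finite_joint b n (\<lambda>i. S (\<tau> i)) T p'"
    and "split_entropy b n S T p U \<le> split_entropy b n (\<lambda>i. S (\<tau> i)) T p' (relabel \<tau> U)"
proof -
  interpret finite_joint b n S T p by fact
  note perm = permute_inputs_in_joint_states[OF \<tau>, of S T]
  have in_range: "\<tau> i \<in> {1..n}" if "i \<in> {1..n}" for i
    using that permutes_in_image[OF \<tau>] by blast
  show fj: "finite_joint b n (\<lambda>i. S (\<tau> i)) T p'"
    using b finite_S[OF in_range] finite_T distr_in_distributions[OF p perm]
    by (intro finite_joint.intro) (auto simp: p'_def)
  then interpret F': finite_joint b n "\<lambda>i. S (\<tau> i)" T p' .
  let ?q = "split_distr b n S T p U"
  have q: "?q \<in> split_family n S T p U"
    by (rule split_distr_in_split_family[OF U])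
  then have q': "?q \<in> distributions (joint_states n S T)"
    by (simp add: split_family_def)
  have preimage: "\<tau> -` A \<subseteq> {1..n}" if "A \<subseteq> {1..n}" for A
    using that permutes_in_image[OF \<tau>] by blast
  then have V: "relabel \<tau> U \<subseteq> Pow {1..n}"
    using U by (auto simp only: relabel_def)
  have "distr ?q (count_space (joint_states n (\<lambda>i. S (\<tau> i)) T)) (permute_inputs n \<tau>) \<in>
      split_family n (\<lambda>i. S (\<tau> i)) T p' (relabel \<tau> U)"
    unfolding p'_def
  proof (rule split_family_distr[OF p q U V perm, where h = "\<lambda>x. \<lambda>i\<in>{1..n}. x (\<tau> i)"])
    show "(\<lambda>x. \<lambda>i\<in>{1..n}. x (\<tau> i)) \<in> states S {1..n} \<rightarrow> states (\<lambda>i. S (\<tau> i)) {1..n}"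
      using in_range unfolding states_def by (intro Pi_I restrict_PiE_iff[THEN iffD2] ballI) (blast dest: PiE_mem)
    fix B assume "B \<in> relabel \<tau> U"
    then obtain A where A: "A \<in> U" "B = \<tau> -` A" by (auto simp: relabel_def)
    \<comment> \<open>Position \<open>i\<close> in \<open>B\<close> shows the input
      \<open>\<tau> i\<close> in \<open>A\<close>, so the marginal on \<open>B\<close> merely
      reindexes the one on \<open>A\<close>.\<close>
    let ?g = "\<lambda>w. (\<lambda>i\<in>B. fst w (\<tau> i), snd w)"
    have g: "?g \<in> states S A \<times> T \<rightarrow> states (\<lambda>i. S (\<tau> i)) B \<times> T"
      unfolding A(2) by (auto simp: states_def PiE_iff)
    have eq: "(restrict (fst (permute_inputs n \<tau> z)) B, snd (permute_inputs n \<tau> z)) =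
        ?g (restrict (fst z) A, snd z)" for z :: "(nat \<Rightarrow> 'a) \<times> 'b"
    proof -
      have "A \<subseteq> {1..n}" using A U by blast
      then have "i \<in> {1..n}" if "\<tau> i \<in> A" for i
        using preimage[of A] that by blast
      then show ?thesis
        unfolding A(2) permute_inputs_def by (auto simp: restrict_def fun_eq_iff simp del: atLeastAtMost_iff)
    qed
    show "\<exists>A\<in>U. \<exists>g\<in>states S A \<times> T \<rightarrow> states (\<lambda>i. S (\<tau> i)) B \<times> T. \<forall>z\<in>joint_states n S T.
        (restrict (fst (permute_inputs n \<tau> z)) B, snd (permute_inputs n \<tau> z)) = g (restrict (fst z) A, snd z)"
      by (intro bexI[of _ A] bexI[of _ ?g] ballI g eq A(1))
  qed (simp add: permute_inputs_def)
  then have "distr_entropy b (joint_states n (\<lambda>i. S (\<tau> i)) T)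
      (distr ?q (count_space (joint_states n (\<lambda>i. S (\<tau> i)) T)) (permute_inputs n \<tau>)) \<le>
      split_entropy b n (\<lambda>i. S (\<tau> i)) T p' (relabel \<tau> U)"
    by (rule F'.entropy_le_split_entropy[OF V])
  then show "split_entropy b n S T p U \<le> split_entropy b n (\<lambda>i. S (\<tau> i)) T p' (relabel \<tau> U)"
    by (simp only: split_entropy_def[of b n S] distr_entropy_bij[OF b finite_joint q' bij_betw_permute_inputs[OF \<tau>]])
qed

lemma split_entropy_permute:
  assumes "finite_joint b n S T p" and \<tau>: "\<tau> permutes {1..n}" and U: "U \<in> input_lattice n"
  defines "p' \<equiv> distr p (count_space (joint_states n (\<lambda>i. S (\<tau> i)) T)) (permute_inputs n \<tau>)"
  shows "split_entropy b n (\<lambda>i. S (\<tau> i)) T p' (relabel \<tau> U) = split_entropy b n S T p U"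
proof (rule antisym)
  interpret finite_joint b n S T p by fact
  note le = split_entropy_permute_le[OF assms(1) \<tau> input_lattice_bounds(2)[OF U], folded p'_def]
  show "split_entropy b n S T p U \<le> split_entropy b n (\<lambda>i. S (\<tau> i)) T p' (relabel \<tau> U)"
    by (rule le)
  have inv: "inv (inv \<tau>) = \<tau>"
    by (rule inv_inv_eq[OF permutes_bij[OF \<tau>]])
  have S: "(\<lambda>i. S (\<tau> (inv \<tau> i))) = S"
    using permutes_inverses(1)[OF \<tau>] by simp
  note perm = permute_inputs_in_joint_states[OF \<tau>, of S T]
  note perm' = permute_inputs_in_joint_states[OF permutes_inv[OF \<tau>], of "\<lambda>i. S (\<tau> i)" T, unfolded S]
  \<comment> \<open>Applying the inequality with the inverse permutation leads back to
    \<open>S\<close>, \<open>p\<close> and \<open>U\<close>; this and its neighbours undo the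
    relabelling of each.\<close>
  have "distr p' (count_space (joint_states n S T)) (permute_inputs n (inv \<tau>)) =
      distr p (count_space (joint_states n S T)) (\<lambda>z. z)"
    unfolding p'_def distr_distr_distributions[OF p perm perm']
    by (rule distr_cong_distributions[OF p]) (rule permute_inputs_compose[OF \<tau>])
  also have "\<dots> = p"
    by (rule distr_id2) (simp add: distributionsD[OF p])
  finally have p': "distr p' (count_space (joint_states n S T)) (permute_inputs n (inv \<tau>)) = p" .
  have U': "relabel (inv \<tau>) (relabel \<tau> U) = U"
    using relabel_inv[OF permutes_inv[OF \<tau>]] by (simp only: inv)
  show "split_entropy b n (\<lambda>i. S (\<tau> i)) T p' (relabel \<tau> U) \<le> split_entropy b n S T p U"
    using split_entropy_permute_le(2)[OF le(1) permutes_inv[OF \<tau>] input_lattice_bounds(2)[OF relabel_in_input_lattice[OF \<tau> U]]]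
    unfolding S p' U' .
qed

lemma info_contribution_permute:
  assumes rvs: "finite_rvs n M S T X Y" and b: "1 < b" and \<tau>: "\<tau> permutes {1..n}"
  shows "info_contribution b n M (\<lambda>i. S (\<tau> i)) T (\<lambda>i. X (\<tau> i)) Y (\<tau> -` A) = info_contribution b n M S T X Y A"
proof -
  let ?p = "joint_distr n M S T X Y" and ?p' = "joint_distr n M (\<lambda>i. S (\<tau> i)) T (\<lambda>i. X (\<tau> i)) Y"
  have in_range: "\<tau> i \<in> {1..n}" if "i \<in> {1..n}" for i
    using that permutes_in_image[OF \<tau>] by blast
  have rvs': "finite_rvs n M (\<lambda>i. S (\<tau> i)) T (\<lambda>i. X (\<tau> i)) Y"
    using rvs in_range unfolding finite_rvs_def by blast
  have "?p' = distr ?p (count_space (joint_states n (\<lambda>i. S (\<tau> i)) T)) (permute_inputs n \<tau>)"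
    unfolding distr_joint_distr[OF rvs permute_inputs_in_joint_states[OF \<tau>]]
    unfolding joint_distr_def using in_range
    by (intro distr_cong) (auto simp: permute_inputs_def tuple_def fun_eq_iff restrict_def)
  then have h: "split_entropy b n (\<lambda>i. S (\<tau> i)) T ?p' (relabel \<tau> U) = split_entropy b n S T ?p U"
    if "U \<in> input_lattice n" for U
    using split_entropy_permute[OF finite_joint_joint_distr[OF rvs b] \<tau> that] by simp
  have inj: "inj_on (\<lambda>(U, V). (relabel \<tau> U, relabel \<tau> V)) (edges n A)"
    using injD[OF inj_relabel[OF \<tau>]] by (auto simp: inj_on_def)
  show ?thesis
    unfolding info_contribution_eq[OF rvs b] info_contribution_eq[OF rvs' b] relabel_edges[OF \<tau>]
      sum.reindex[OF inj]
    using edges_subset by (intro arg_cong2[where f = "(*)"] sum.cong)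
      (auto simp: relabel_num_chains_through[OF \<tau>] h subset_iff)
qed

section \<open>An output that copies the inputs\<close>

text \<open>When the inputs in \<open>A\<close> agree almost surely with the corresponding
  coordinates of the output, the output alone determines this marginal.\<close>

lemma subset_marginal_copy:
  assumes q: "q \<in> distributions (joint_states n S (states S {1..n}))" and A: "A \<subseteq> {1..n}"
    and eq: "\<And>i. i \<in> A \<Longrightarrow> measure q {z \<in> joint_states n S (states S {1..n}). fst z i \<noteq> snd z i} = 0"
  shows "subset_marginal S (states S {1..n}) A q =
    distr (distr q (count_space (states S {1..n})) snd)
      (count_space (states S A \<times> states S {1..n})) (\<lambda>y. (restrict y A, y))"
proof -
  let ?T = "states S {1..n}"
  interpret prob_space q using distributionsD(1)[OF q] .
  have "AE z in q. fst z i = snd z i" if "i \<in> A" for i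
  proof (rule AE_I')
    show "{z \<in> joint_states n S ?T. fst z i \<noteq> snd z i} \<in> null_sets q"
      using eq[OF that] distributionsD(2)[OF q] by (intro null_setsI) (auto simp: emeasure_eq_measure)
  qed (simp add: distributionsD(3)[OF q])
  moreover have "finite A"
    using A by (rule finite_subset) simp
  ultimately have "AE z in q. \<forall>i\<in>A. fst z i = snd z i"
    by (simp add: AE_finite_all)
  then have AE: "AE z in q. (restrict (fst z) A, snd z) = (restrict (snd z) A, snd z)"
    by eventually_elim (auto simp: restrict_def fun_eq_iff)
  have restr: "(\<lambda>y. (restrict y A, y)) \<in> ?T \<rightarrow> states S A \<times> ?T"
    using A by (auto simp: states_def PiE_iff)
  have snd: "snd \<in> joint_states n S ?T \<rightarrow> ?T" by auto
  have "(\<lambda>z. (restrict (snd z) A, snd z)) \<in> joint_states n S ?T \<rightarrow> states S A \<times> ?T"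
    using restr by auto
  moreover have "(\<lambda>z. (restrict (fst z) A, snd z)) \<in> joint_states n S ?T \<rightarrow> states S A \<times> ?T"
    by (intro Pi_I restrict_in_states[OF A])
  ultimately have "distr q (count_space (states S A \<times> ?T)) (\<lambda>z. (restrict (fst z) A, snd z)) =
      distr q (count_space (states S A \<times> ?T)) (\<lambda>z. (restrict (snd z) A, snd z))"
    using AE by (intro distr_cong_AE distributions_measurable[OF q]) auto
  then show ?thesis
    unfolding subset_marginal_eq distr_distr_distributions[OF q snd restr] .
qed

text \<open>The constraint of a singleton \<open>{i}\<close> fixes the probability that input
  \<open>i\<close> differs from its copy, which is 0 under \<open>p\<close>. Every competitor is
  therefore concentrated on agreement over \<open>A\<close>, and the empty set fixes the law of the
  output, which then determines the marginal on \<open>A\<close>.\<close>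

lemma split_family_copy:
  assumes rvs: "finite_rvs n M S T X Y"
  defines "p \<equiv> joint_distr n M S (states S {1..n}) X (tuple n X)"
  assumes A: "A \<subseteq> {1..n}" and U: "{} \<in> U" "\<And>i. i \<in> A \<Longrightarrow> {i} \<in> U"
  shows "split_family n S (states S {1..n}) p (insert A U) = split_family n S (states S {1..n}) p U"
proof -
  let ?T = "states S {1..n}"
  let ?\<Omega> = "joint_states n S ?T"
  have "finite ?T"
    using rvs unfolding states_def finite_rvs_def by (auto intro!: finite_PiE)
  then have rvs': "finite_rvs n M S ?T X (tuple n X)"
    using rvs tuple_measurable[OF rvs] by (simp add: finite_rvs_def)
  have p: "p \<in> distributions ?\<Omega>"
    unfolding p_def by (rule joint_distr_in_distributions[OF rvs'])
  have diag: "measure p {z\<in>?\<Omega>. fst z i \<noteq> snd z i} = 0" for i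
  proof -
    have "(\<lambda>\<omega>. (tuple n X \<omega>, tuple n X \<omega>)) -` {z\<in>?\<Omega>. fst z i \<noteq> snd z i} \<inter> space M = {}"
      by auto
    then show ?thesis
      unfolding p_def joint_distr_def
      by (subst measure_distr[OF joint_measurable[OF rvs']]) auto
  qed
  have snd: "snd \<in> ?\<Omega> \<rightarrow> ?T" by auto
  have "subset_marginal S ?T A q = subset_marginal S ?T A p" if q: "q \<in> split_family n S ?T p U" for q
  proof -
    have q': "q \<in> distributions ?\<Omega>" "\<And>B. B \<in> U \<Longrightarrow> subset_marginal S ?T B q = subset_marginal S ?T B p"
      using q by (auto simp: split_family_def)
    have "measure q {z\<in>?\<Omega>. fst z i \<noteq> snd z i} = 0" if i: "i \<in> A" for i
    proof -
      have i': "{i} \<subseteq> {1..n}" using i A by auto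
      \<comment> \<open>The event of disagreement is treated as a Boolean variable, which is a
        function of the pair of input \<open>i\<close> and the output.\<close>
      have "distr q (count_space UNIV) (\<lambda>z. fst z i \<noteq> snd z i) = distr p (count_space UNIV) (\<lambda>z. fst z i \<noteq> snd z i)"
      proof (rule distr_eq_factor[OF q'(2)[OF U(2)[OF i], unfolded subset_marginal_eq] q'(1) p,
            where h = "\<lambda>w. fst w i \<noteq> snd w i"])
        show "(\<lambda>z. (restrict (fst z) {i}, snd z)) \<in> ?\<Omega> \<rightarrow> states S {i} \<times> ?T"
          by (intro Pi_I restrict_in_states[OF i'])
      qed simp_all
      then have "measure q {z\<in>?\<Omega>. (fst z i \<noteq> snd z i) = True} = measure p {z\<in>?\<Omega>. (fst z i \<noteq> snd z i) = True}"
        using measure_distr_singleton[OF q'(1), of "\<lambda>z. fst z i \<noteq> snd z i" UNIV True]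
          measure_distr_singleton[OF p, of "\<lambda>z. fst z i \<noteq> snd z i" UNIV True] by simp
      then show ?thesis
        using diag by simp
    qed
    note copy = subset_marginal_copy[OF q'(1) A this] subset_marginal_copy[OF p A diag]
    have "distr q (count_space ?T) snd = distr p (count_space ?T) snd"
      by (rule distr_eq_factor[OF q'(2)[OF U(1), unfolded subset_marginal_eq] q'(1) p, where h = snd])
        (auto simp: states_def)
    with copy show ?thesis by simp
  qed
  then show ?thesis
    by (auto simp: split_family_def)
qed

lemma info_contribution_copy:
  assumes rvs: "finite_rvs n M S T X Y" and b: "1 < b" and A: "card A > 1"
  shows "info_contribution b n M S (states S {1..n}) X (tuple n X) A = 0"
proof -
  let ?T = "states S {1..n}"
  let ?p = "joint_distr n M S ?T X (tuple n X)"
  have "finite ?T"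
    using rvs unfolding states_def finite_rvs_def by (auto intro!: finite_PiE)
  then have rvs': "finite_rvs n M S ?T X (tuple n X)"
    using rvs tuple_measurable[OF rvs] by (simp add: finite_rvs_def)
  have "split_entropy b n S ?T ?p V = split_entropy b n S ?T ?p U" if UV: "(U, V) \<in> edges n A" for U V
  proof -
    have V: "V = insert A U" "V \<in> input_lattice n" and U: "U \<in> input_lattice n"
      using UV by (auto simp: edges_def)
    have "{i} \<in> U" if "i \<in> A" for i
    proof -
      have "{i} \<in> V"
        using V that by (auto simp: input_lattice_def simplicial_complex_def)
      \<comment> \<open>This is where \<open>A\<close> must have more than one element: the
        singletons then differ from the added set and already lie in \<open>U\<close>.\<close>
      moreover have "{i} \<noteq> A"
        using A by auto
      ultimately show ?thesis
        using V(1) by simp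
    qed
    moreover have "{} \<in> U"
      using input_lattice_bounds(1)[OF U] by simp
    moreover have "A \<subseteq> {1..n}"
      using input_lattice_bounds(2)[OF V(2)] V(1) by blast
    ultimately have "split_family n S ?T ?p V = split_family n S ?T ?p U"
      unfolding V(1) by (intro split_family_copy[OF rvs])
    then show ?thesis
      by (simp add: split_entropy_def split_distr_def)
  qed
  then show ?thesis
    unfolding info_contribution_eq[OF rvs' b] by (auto intro!: sum.neutral)
qed

section \<open>Independent pairs\<close>

definition map_joint :: "nat \<Rightarrow> ('a \<Rightarrow> 'b) \<Rightarrow> ('y \<Rightarrow> 'u) \<Rightarrow> (nat \<Rightarrow> 'a) \<times> 'y \<Rightarrow> (nat \<Rightarrow> 'b) \<times> 'u" where
  "map_joint n f g z = (\<lambda>i\<in>{1..n}. f (fst z i), g (snd z))"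

text \<open>Interleaves a state of each system into one state of pairs; the two projections
  \<open>map_joint n fst fst\<close> and \<open>map_joint n snd snd\<close> together form its
  inverse.\<close>

definition zip_joint ::
  "nat \<Rightarrow> ((nat \<Rightarrow> 'b) \<times> 'u) \<times> ((nat \<Rightarrow> 'c) \<times> 'v) \<Rightarrow> (nat \<Rightarrow> 'b \<times> 'c) \<times> ('u \<times> 'v)" where
  "zip_joint n w = (\<lambda>i\<in>{1..n}. (fst (fst w) i, fst (snd w) i), (snd (fst w), snd (snd w)))"

lemma map_joint_in_joint_states:
  assumes "\<And>i. f \<in> S i \<rightarrow> S' i" "g \<in> T \<rightarrow> T'"
  shows "map_joint n f g \<in> joint_states n S T \<rightarrow> joint_states n S' T'"
  using assms by (auto simp: map_joint_def states_def PiE_iff Pi_iff)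

text \<open>A map applied coordinate by coordinate commutes with restriction to \<open>B\<close>, so
  each constraint is carried to the constraint of the same set.\<close>

lemma split_family_map_joint:
  assumes p: "p \<in> distributions (joint_states n S T)" and U: "U \<subseteq> Pow {1..n}"
    and f: "\<And>i. f \<in> S i \<rightarrow> S' i" and g: "g \<in> T \<rightarrow> T'" and q: "q \<in> split_family n S T p U"
  shows "distr q (count_space (joint_states n S' T')) (map_joint n f g) \<in>
    split_family n S' T' (distr p (count_space (joint_states n S' T')) (map_joint n f g)) U"
proof (rule split_family_distr[OF p q U U map_joint_in_joint_states[OF f g], where h = "\<lambda>x. \<lambda>i\<in>{1..n}. f (x i)"])
  show "(\<lambda>x. \<lambda>i\<in>{1..n}. f (x i)) \<in> states S {1..n} \<rightarrow> states S' {1..n}"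
    using f by (auto simp: states_def PiE_iff Pi_iff)
  fix B assume B: "B \<in> U"
  let ?g = "\<lambda>w. (\<lambda>i\<in>B. f (fst w i), g (snd w))"
  have h: "?g \<in> states S B \<times> T \<rightarrow> states S' B \<times> T'"
    using f g by (auto simp: states_def PiE_iff Pi_iff)
  have eq: "(restrict (fst (map_joint n f g z)) B, snd (map_joint n f g z)) = ?g (restrict (fst z) B, snd z)"
    for z :: "(nat \<Rightarrow> 'a) \<times> 'b"
  proof -
    have "i \<in> {1..n}" if "i \<in> B" for i using B U that by blast
    then show ?thesis
      by (auto simp: map_joint_def restrict_def fun_eq_iff simp del: atLeastAtMost_iff)
  qed
  show "\<exists>A\<in>U. \<exists>h\<in>states S A \<times> T \<rightarrow> states S' B \<times> T'. \<forall>z\<in>joint_states n S T.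
      (restrict (fst (map_joint n f g z)) B, snd (map_joint n f g z)) = h (restrict (fst z) A, snd z)"
    by (intro bexI[of _ B] bexI[of _ ?g] ballI h eq B)
qed (simp add: map_joint_def)

text \<open>Version of \<open>distr_eq_factor\<close> for two independent components: the image of a
  product under a pair of maps is the product of the images, so agreement of each factor
  suffices.\<close>

lemma distr_pair_eq_factor:
  assumes eq1: "distr q1 (count_space \<Omega>1') g1 = distr p1 (count_space \<Omega>1') g1"
    and eq2: "distr q2 (count_space \<Omega>2') g2 = distr p2 (count_space \<Omega>2') g2"
    and q: "q1 \<in> distributions \<Omega>1" "q2 \<in> distributions \<Omega>2"
    and p: "p1 \<in> distributions \<Omega>1" "p2 \<in> distributions \<Omega>2"
    and g: "g1 \<in> \<Omega>1 \<rightarrow> \<Omega>1'" "g2 \<in> \<Omega>2 \<rightarrow> \<Omega>2'"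
    and fin: "finite \<Omega>1" "finite \<Omega>2" "finite \<Omega>1'" "finite \<Omega>2'"
    and h: "h \<in> \<Omega>1' \<times> \<Omega>2' \<rightarrow> \<Omega>''" "\<And>z. z \<in> \<Omega>1 \<times> \<Omega>2 \<Longrightarrow> k z = h (g1 (fst z), g2 (snd z))"
  shows "distr (q1 \<Otimes>\<^sub>M q2) (count_space \<Omega>'') k = distr (p1 \<Otimes>\<^sub>M p2) (count_space \<Omega>'') k"
proof -
  have prod: "distr (m1 \<Otimes>\<^sub>M m2) (count_space (\<Omega>1' \<times> \<Omega>2')) (\<lambda>z. (g1 (fst z), g2 (snd z))) =
      distr m1 (count_space \<Omega>1') g1 \<Otimes>\<^sub>M distr m2 (count_space \<Omega>2') g2"
    if m: "m1 \<in> distributions \<Omega>1" "m2 \<in> distributions \<Omega>2" for m1 m2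
  proof -
    interpret prob_space "distr m2 (count_space \<Omega>2') g2"
      using distributionsD(1)[OF distr_in_distributions[OF m(2) g(2)]] .
    show ?thesis
      using pair_measure_distr[OF distributions_measurable[OF m(1) g(1)] distributions_measurable[OF m(2) g(2)]
          sigma_finite_measure_axioms]
      by (simp add: pair_measure_count_space[OF fin(3,4)] case_prod_unfold)
  qed
  show ?thesis
  proof (rule distr_eq_factor[OF _ pair_measure_in_distributions(1)[OF q fin(1,2)]
        pair_measure_in_distributions(1)[OF p fin(1,2)] _ h])
    show "distr (q1 \<Otimes>\<^sub>M q2) (count_space (\<Omega>1' \<times> \<Omega>2')) (\<lambda>z. (g1 (fst z), g2 (snd z))) =
        distr (p1 \<Otimes>\<^sub>M p2) (count_space (\<Omega>1' \<times> \<Omega>2')) (\<lambda>z. (g1 (fst z), g2 (snd z)))"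
      unfolding prod[OF q] prod[OF p] eq1 eq2 ..
  qed (use g in auto)
qed

lemma zip_joint_in_joint_states:
  "zip_joint n \<in> joint_states n S1 T1 \<times> joint_states n S2 T2 \<rightarrow> joint_states n (\<lambda>i. S1 i \<times> S2 i) (T1 \<times> T2)"
  by (auto simp: zip_joint_def states_def PiE_iff)

lemma unzip_zip_joint:
  assumes "w \<in> joint_states n S1 T1 \<times> joint_states n S2 T2"
  shows "map_joint n fst fst (zip_joint n w) = fst w" "map_joint n snd snd (zip_joint n w) = snd w"
proof -
  have restr: "restrict (fst (fst w)) {1..n} = fst (fst w)" "restrict (fst (snd w)) {1..n} = fst (snd w)"
    using assms by (auto simp only: states_def mem_Times_iff PiE_restrict)
  have "(\<lambda>i\<in>{1..n}. fst ((\<lambda>i\<in>{1..n}. (fst (fst w) i, fst (snd w) i)) i)) = restrict (fst (fst w)) {1..n}"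
    by (rule restrict_ext) simp
  then show "map_joint n fst fst (zip_joint n w) = fst w"
    unfolding zip_joint_def map_joint_def by (simp only: restr fst_conv snd_conv prod.collapse)
  have "(\<lambda>i\<in>{1..n}. snd ((\<lambda>i\<in>{1..n}. (fst (fst w) i, fst (snd w) i)) i)) = restrict (fst (snd w)) {1..n}"
    by (rule restrict_ext) simp
  then show "map_joint n snd snd (zip_joint n w) = snd w"
    unfolding zip_joint_def map_joint_def by (simp only: restr fst_conv snd_conv prod.collapse)
qed

lemma zip_unzip_joint:
  assumes "z \<in> joint_states n (\<lambda>i. S1 i \<times> S2 i) (T1 \<times> T2)"
  shows "zip_joint n (map_joint n fst fst z, map_joint n snd snd z) = z"
proof -
  have "restrict (fst z) {1..n} = fst z"
    using assms by (auto simp only: states_def mem_Times_iff PiE_restrict)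
  moreover have "(\<lambda>i\<in>{1..n}. ((\<lambda>i\<in>{1..n}. fst (fst z i)) i, (\<lambda>i\<in>{1..n}. snd (fst z i)) i)) = restrict (fst z) {1..n}"
    by (rule restrict_ext) simp
  ultimately show ?thesis
    unfolding zip_joint_def map_joint_def by (simp only: fst_conv snd_conv prod.collapse)
qed

lemma unzip_in_joint_states:
  "map_joint n fst fst \<in> joint_states n (\<lambda>i. S1 i \<times> S2 i) (T1 \<times> T2) \<rightarrow> joint_states n S1 T1"
  "map_joint n snd snd \<in> joint_states n (\<lambda>i. S1 i \<times> S2 i) (T1 \<times> T2) \<rightarrow> joint_states n S2 T2"
  by (rule map_joint_in_joint_states; auto)+

lemma bij_betw_zip_joint:
  "bij_betw (zip_joint n) (joint_states n S1 T1 \<times> joint_states n S2 T2) (joint_states n (\<lambda>i. S1 i \<times> S2 i) (T1 \<times> T2))"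
  "bij_betw (\<lambda>z. (map_joint n fst fst z, map_joint n snd snd z))
     (joint_states n (\<lambda>i. S1 i \<times> S2 i) (T1 \<times> T2)) (joint_states n S1 T1 \<times> joint_states n S2 T2)"
proof -
  let ?zip = "zip_joint n" and ?unzip = "\<lambda>z. (map_joint n fst fst z, map_joint n snd snd z)"
  let ?\<Omega>1 = "joint_states n S1 T1" and ?\<Omega>2 = "joint_states n S2 T2"
  let ?\<Omega> = "joint_states n (\<lambda>i. S1 i \<times> S2 i) (T1 \<times> T2)"
  have zip: "?zip ` (?\<Omega>1 \<times> ?\<Omega>2) \<subseteq> ?\<Omega>"
    using zip_joint_in_joint_states by blast
  have unzip: "?unzip ` ?\<Omega> \<subseteq> ?\<Omega>1 \<times> ?\<Omega>2"
    using unzip_in_joint_states[of n S1 S2 T1 T2] by blast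
  have unzip_zip: "\<forall>w\<in>?\<Omega>1 \<times> ?\<Omega>2. ?unzip (?zip w) = w"
    using unzip_zip_joint by (metis prod.collapse)
  have zip_unzip: "\<forall>z\<in>?\<Omega>. ?zip (?unzip z) = z"
    using zip_unzip_joint by blast
  show "bij_betw ?zip (?\<Omega>1 \<times> ?\<Omega>2) ?\<Omega>"
    by (rule bij_betw_byWitness[OF unzip_zip zip_unzip zip unzip])
  show "bij_betw ?unzip ?\<Omega> (?\<Omega>1 \<times> ?\<Omega>2)"
    by (rule bij_betw_byWitness[OF zip_unzip unzip_zip unzip zip])
qed

lemma split_entropy_additive:
  assumes F1: "finite_joint b n S1 T1 p1" and F2: "finite_joint b n S2 T2 p2" and U: "U \<subseteq> Pow {1..n}"
  defines "p \<equiv> distr (p1 \<Otimes>\<^sub>M p2) (count_space (joint_states n (\<lambda>i. S1 i \<times> S2 i) (T1 \<times> T2))) (zip_joint n)"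
  shows "split_entropy b n (\<lambda>i. S1 i \<times> S2 i) (T1 \<times> T2) p U =
    split_entropy b n S1 T1 p1 U + split_entropy b n S2 T2 p2 U"
proof (rule antisym)
  interpret F1: finite_joint b n S1 T1 p1 by fact
  interpret F2: finite_joint b n S2 T2 p2 by fact
  let ?S = "\<lambda>i. S1 i \<times> S2 i" and ?T = "T1 \<times> T2"
  let ?\<Omega>1 = "joint_states n S1 T1" and ?\<Omega>2 = "joint_states n S2 T2" and ?\<Omega> = "joint_states n ?S ?T"
  note fin = F1.finite_joint F2.finite_joint
  note zip = zip_joint_in_joint_states[of n S1 T1 S2 T2]
  note pair = pair_measure_in_distributions(1)[OF F1.p F2.p fin]
  have p: "p \<in> distributions ?\<Omega>"
    unfolding p_def by (rule distr_in_distributions[OF pair zip])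
  interpret F: finite_joint b n ?S ?T p
    using F1.b F1.finite_S F2.finite_S F1.finite_T F2.finite_T p by (intro finite_joint.intro) auto

  let ?r1 = "split_distr b n S1 T1 p1 U" and ?r2 = "split_distr b n S2 T2 p2 U"
  have r1: "?r1 \<in> distributions ?\<Omega>1" "input_marginal n S1 ?r1 = input_marginal n S1 p1"
      "\<And>A. A \<in> U \<Longrightarrow> subset_marginal S1 T1 A ?r1 = subset_marginal S1 T1 A p1"
    using F1.split_distr_in_split_family[OF U] by (auto simp: split_family_def)
  have r2: "?r2 \<in> distributions ?\<Omega>2" "input_marginal n S2 ?r2 = input_marginal n S2 p2"
      "\<And>A. A \<in> U \<Longrightarrow> subset_marginal S2 T2 A ?r2 = subset_marginal S2 T2 A p2"
    using F2.split_distr_in_split_family[OF U] by (auto simp: split_family_def)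
  note r12 = pair_measure_in_distributions(1)[OF r1(1) r2(1) fin]
  \<comment> \<open>The product of the two maximisers, written as a distribution of pairs; its
    constraints follow factor by factor, which gives the lower bound.\<close>
  let ?r = "distr (?r1 \<Otimes>\<^sub>M ?r2) (count_space ?\<Omega>) (zip_joint n)"
  have fst: "fst \<in> ?\<Omega> \<rightarrow> states ?S {1..n}" by auto
  have "distr (?r1 \<Otimes>\<^sub>M ?r2) (count_space (states ?S {1..n})) (\<lambda>w. fst (zip_joint n w)) =
      distr (p1 \<Otimes>\<^sub>M p2) (count_space (states ?S {1..n})) (\<lambda>w. fst (zip_joint n w))"
    by (rule distr_pair_eq_factor[OF r1(2)[unfolded input_marginal_def] r2(2)[unfolded input_marginal_def]
          r1(1) r2(1) F1.p F2.p _ _ fin F1.finite_states F2.finite_states,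
          where h = "\<lambda>x. \<lambda>i\<in>{1..n}. (fst x i, snd x i)"])
      (auto simp: zip_joint_def states_def PiE_iff)
  then have "input_marginal n ?S ?r = input_marginal n ?S p"
    unfolding input_marginal_def p_def
    by (simp only: distr_distr_distributions[OF r12 zip fst] distr_distr_distributions[OF pair zip fst])
  moreover have "subset_marginal ?S ?T A ?r = subset_marginal ?S ?T A p" if "A \<in> U" for A
  proof -
    have A: "A \<subseteq> {1..n}" using that U by blast
    then have "finite (states S1 A)" "finite (states S2 A)"
      unfolding states_def using F1.finite_S F2.finite_S by (auto intro!: finite_PiE intro: finite_subset)
    then have finA: "finite (states S1 A \<times> T1)" "finite (states S2 A \<times> T2)"
      using F1.finite_T F2.finite_T by auto
    have in_range: "i \<in> {1..n}" if "i \<in> A" for i using A that by blast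
    have restr1: "(\<lambda>z. (restrict (fst z) A, snd z)) \<in> ?\<Omega>1 \<rightarrow> states S1 A \<times> T1"
      by (intro Pi_I restrict_in_states[OF A])
    have restr2: "(\<lambda>z. (restrict (fst z) A, snd z)) \<in> ?\<Omega>2 \<rightarrow> states S2 A \<times> T2"
      by (intro Pi_I restrict_in_states[OF A])
    have restr: "(\<lambda>z. (restrict (fst z) A, snd z)) \<in> ?\<Omega> \<rightarrow> states ?S A \<times> ?T"
      by (intro Pi_I restrict_in_states[OF A])
    have "distr (?r1 \<Otimes>\<^sub>M ?r2) (count_space (states ?S A \<times> ?T)) (\<lambda>w. (restrict (fst (zip_joint n w)) A, snd (zip_joint n w))) =
        distr (p1 \<Otimes>\<^sub>M p2) (count_space (states ?S A \<times> ?T)) (\<lambda>w. (restrict (fst (zip_joint n w)) A, snd (zip_joint n w)))"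
    proof (rule distr_pair_eq_factor[OF r1(3)[OF that, unfolded subset_marginal_eq]
          r2(3)[OF that, unfolded subset_marginal_eq] r1(1) r2(1) F1.p F2.p restr1 restr2 fin finA,
          where h = "\<lambda>w. (\<lambda>i\<in>A. (fst (fst w) i, fst (snd w) i), (snd (fst w), snd (snd w)))"])
      show "(\<lambda>w. (\<lambda>i\<in>A. (fst (fst w) i, fst (snd w) i), snd (fst w), snd (snd w))) \<in>
          (states S1 A \<times> T1) \<times> (states S2 A \<times> T2) \<rightarrow> states ?S A \<times> ?T"
        by (auto simp: states_def PiE_iff)
    qed (use in_range in \<open>auto simp: zip_joint_def restrict_def fun_eq_iff simp del: atLeastAtMost_iff\<close>)
    then show ?thesis
      unfolding subset_marginal_eq p_def
      by (simp only: distr_distr_distributions[OF r12 zip restr] distr_distr_distributions[OF pair zip restr])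
  qed
  ultimately have "?r \<in> split_family n ?S ?T p U"
    using distr_in_distributions[OF r12 zip] by (simp add: split_family_def)
  then have "distr_entropy b ?\<Omega> ?r \<le> split_entropy b n ?S ?T p U"
    by (rule F.entropy_le_split_entropy[OF U])
  moreover have "distr_entropy b ?\<Omega> ?r = split_entropy b n S1 T1 p1 U + split_entropy b n S2 T2 p2 U"
    unfolding split_entropy_def
      distr_entropy_bij[OF F1.b finite_cartesian_product[OF fin] r12 bij_betw_zip_joint(1)]
      distr_entropy_pair_measure[OF F1.b fin r1(1) r2(1)] ..
  ultimately show "split_entropy b n S1 T1 p1 U + split_entropy b n S2 T2 p2 U \<le> split_entropy b n ?S ?T p U"
    by simp

  let ?q = "split_distr b n ?S ?T p U"
  let ?unzip = "\<lambda>z. (map_joint n fst fst z, map_joint n snd snd z)"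
  have q: "?q \<in> split_family n ?S ?T p U"
    by (rule F.split_distr_in_split_family[OF U])
  then have q': "?q \<in> distributions ?\<Omega>"
    by (simp add: split_family_def)
  have unzip: "?unzip \<in> ?\<Omega> \<rightarrow> ?\<Omega>1 \<times> ?\<Omega>2"
    using bij_betw_imp_funcset[OF bij_betw_zip_joint(2)] .
  have fs: "fst \<in> ?\<Omega>1 \<times> ?\<Omega>2 \<rightarrow> ?\<Omega>1" "snd \<in> ?\<Omega>1 \<times> ?\<Omega>2 \<rightarrow> ?\<Omega>2" by auto
  \<comment> \<open>Projecting \<open>p\<close> returns \<open>p1\<close> and \<open>p2\<close>, so
    the projections of the joint maximiser compete in the two separate families.\<close>
  have "distr p (count_space ?\<Omega>1) (map_joint n fst fst) = distr (p1 \<Otimes>\<^sub>M p2) (count_space ?\<Omega>1) fst"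
    unfolding p_def distr_distr_distributions[OF pair zip unzip_in_joint_states(1)]
    by (rule distr_cong_distributions[OF pair]) (rule unzip_zip_joint)
  then have p1: "distr p (count_space ?\<Omega>1) (map_joint n fst fst) = p1"
    by (simp only: marginals_pair_measure[OF F1.p F2.p])
  have "distr p (count_space ?\<Omega>2) (map_joint n snd snd) = distr (p1 \<Otimes>\<^sub>M p2) (count_space ?\<Omega>2) snd"
    unfolding p_def distr_distr_distributions[OF pair zip unzip_in_joint_states(2)]
    by (rule distr_cong_distributions[OF pair]) (rule unzip_zip_joint)
  then have p2: "distr p (count_space ?\<Omega>2) (map_joint n snd snd) = p2"
    by (simp only: marginals_pair_measure[OF F1.p F2.p])
  have "distr ?q (count_space ?\<Omega>1) (map_joint n fst fst) \<in> split_family n S1 T1 p1 U"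
    unfolding p1[symmetric] by (rule split_family_map_joint[OF p U _ _ q]) auto
  note le1 = F1.entropy_le_split_entropy[OF U this]
  have "distr ?q (count_space ?\<Omega>2) (map_joint n snd snd) \<in> split_family n S2 T2 p2 U"
    unfolding p2[symmetric] by (rule split_family_map_joint[OF p U _ _ q]) auto
  note le2 = F2.entropy_le_split_entropy[OF U this]
  \<comment> \<open>Unzipping preserves entropy and exhibits the two systems as the factors of a
    product set, where subadditivity gives the upper bound.\<close>
  have "split_entropy b n ?S ?T p U = distr_entropy b (?\<Omega>1 \<times> ?\<Omega>2) (distr ?q (count_space (?\<Omega>1 \<times> ?\<Omega>2)) ?unzip)"
    unfolding split_entropy_def
    by (rule distr_entropy_bij[OF F1.b F.finite_joint q' bij_betw_zip_joint(2), symmetric])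
  also have "\<dots> \<le> distr_entropy b ?\<Omega>1 (distr ?q (count_space ?\<Omega>1) (map_joint n fst fst)) +
      distr_entropy b ?\<Omega>2 (distr ?q (count_space ?\<Omega>2) (map_joint n snd snd))"
    using distr_entropy_le_marginals[OF F1.b fin distr_in_distributions[OF q' unzip]]
    by (simp only: distr_distr_distributions[OF q' unzip fs(1)] distr_distr_distributions[OF q' unzip fs(2)] fst_conv snd_conv)
  also have "\<dots> \<le> split_entropy b n S1 T1 p1 U + split_entropy b n S2 T2 p2 U"
    using le1 le2 by simp
  finally show "split_entropy b n ?S ?T p U \<le> split_entropy b n S1 T1 p1 U + split_entropy b n S2 T2 p2 U" .
qed

lemma info_contribution_additive:
  fixes X1 :: "nat \<Rightarrow> 'w \<Rightarrow> 'b" and X2 :: "nat \<Rightarrow> 'w \<Rightarrow> 'c" and Y1 :: "'w \<Rightarrow> 'u" and Y2 :: "'w \<Rightarrow> 'v"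
  assumes b: "1 < b" and rvs: "finite_rvs n M S1 T1 X1 Y1" "finite_rvs n M S2 T2 X2 Y2"
  defines "p \<equiv> joint_distr n M (\<lambda>i. S1 i \<times> S2 i) (T1 \<times> T2) (\<lambda>i \<omega>. (X1 i \<omega>, X2 i \<omega>)) (\<lambda>\<omega>. (Y1 \<omega>, Y2 \<omega>))"
  assumes indep: "\<And>x1 x2 y1 y2. x1 \<in> states S1 {1..n} \<Longrightarrow> x2 \<in> states S2 {1..n} \<Longrightarrow> y1 \<in> T1 \<Longrightarrow> y2 \<in> T2 \<Longrightarrow>
      measure p {(\<lambda>i\<in>{1..n}. (x1 i, x2 i), (y1, y2))} =
      measure (joint_distr n M S1 T1 X1 Y1) {(x1, y1)} * measure (joint_distr n M S2 T2 X2 Y2) {(x2, y2)}"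
  shows "info_contribution b n M (\<lambda>i. S1 i \<times> S2 i) (T1 \<times> T2) (\<lambda>i \<omega>. (X1 i \<omega>, X2 i \<omega>)) (\<lambda>\<omega>. (Y1 \<omega>, Y2 \<omega>)) A =
    info_contribution b n M S1 T1 X1 Y1 A + info_contribution b n M S2 T2 X2 Y2 A"
proof -
  let ?S = "\<lambda>i. S1 i \<times> S2 i" and ?T = "T1 \<times> T2"
  let ?p1 = "joint_distr n M S1 T1 X1 Y1" and ?p2 = "joint_distr n M S2 T2 X2 Y2"
  let ?\<Omega>1 = "joint_states n S1 T1" and ?\<Omega>2 = "joint_states n S2 T2" and ?\<Omega> = "joint_states n ?S ?T"
  have pair_rv: "(\<lambda>\<omega>. (f \<omega>, g \<omega>)) \<in> M \<rightarrow>\<^sub>M count_space (A \<times> B)"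
    if "finite A" "finite B" "f \<in> M \<rightarrow>\<^sub>M count_space A" "g \<in> M \<rightarrow>\<^sub>M count_space B"
    for f g and A :: "'e set" and B :: "'f set"
    using measurable_Pair[OF that(3,4)] by (simp only: pair_measure_count_space[OF that(1,2)])
  have rvs12: "finite_rvs n M ?S ?T (\<lambda>i \<omega>. (X1 i \<omega>, X2 i \<omega>)) (\<lambda>\<omega>. (Y1 \<omega>, Y2 \<omega>))"
    using rvs unfolding finite_rvs_def by (auto intro!: pair_rv)
  interpret F1: finite_joint b n S1 T1 ?p1 by (rule finite_joint_joint_distr[OF rvs(1) b])
  interpret F2: finite_joint b n S2 T2 ?p2 by (rule finite_joint_joint_distr[OF rvs(2) b])
  interpret F: finite_joint b n ?S ?T p unfolding p_def by (rule finite_joint_joint_distr[OF rvs12 b])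
  note pair = pair_measure_in_distributions[OF F1.p F2.p F1.finite_joint F2.finite_joint]
  note zip = zip_joint_in_joint_states[of n S1 T1 S2 T2]
  \<comment> \<open>The assumed factorisation of point probabilities identifies \<open>p\<close>
    with the zipped product; as zipping is injective, every fibre is a single point.\<close>
  have "p = distr (?p1 \<Otimes>\<^sub>M ?p2) (count_space ?\<Omega>) (zip_joint n)"
  proof (rule distributions_eqI[OF F.p distr_in_distributions[OF pair(1) zip] F.finite_joint])
    fix z assume "z \<in> ?\<Omega>"
    then obtain w where w: "w \<in> ?\<Omega>1 \<times> ?\<Omega>2" "z = zip_joint n w"
      using bij_betw_zip_joint(1)[of n S1 T1 S2 T2] unfolding bij_betw_def by blast
    have "{v \<in> ?\<Omega>1 \<times> ?\<Omega>2. zip_joint n v = z} = {w}"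
      using w bij_betw_zip_joint(1)[of n S1 T1 S2 T2] by (auto simp only: bij_betw_def dest: inj_onD)
    then have "measure (distr (?p1 \<Otimes>\<^sub>M ?p2) (count_space ?\<Omega>) (zip_joint n)) {z} = measure (?p1 \<Otimes>\<^sub>M ?p2) {w}"
      using measure_distr_singleton[OF pair(1) zip \<open>z \<in> ?\<Omega>\<close>] by simp
    also have "\<dots> = measure ?p1 {fst w} * measure ?p2 {snd w}"
      using pair(2)[of "fst w" "snd w"] by simp
    also have "\<dots> = measure p {z}"
      using indep[of "fst (fst w)" "fst (snd w)" "snd (fst w)" "snd (snd w)"] w
      by (auto simp only: zip_joint_def mem_Times_iff prod.collapse)
    finally show "measure p {z} = measure (distr (?p1 \<Otimes>\<^sub>M ?p2) (count_space ?\<Omega>) (zip_joint n)) {z}" ..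
  qed
  then have h: "split_entropy b n ?S ?T p U = split_entropy b n S1 T1 ?p1 U + split_entropy b n S2 T2 ?p2 U"
    if "U \<subseteq> Pow {1..n}" for U
    using split_entropy_additive[OF F1.finite_joint_axioms F2.finite_joint_axioms that] by simp
  have "split_entropy b n ?S ?T p U - split_entropy b n ?S ?T p V =
      (split_entropy b n S1 T1 ?p1 U - split_entropy b n S1 T1 ?p1 V) +
      (split_entropy b n S2 T2 ?p2 U - split_entropy b n S2 T2 ?p2 V)" if "(U, V) \<in> edges n A" for U V
    using h[of U] h[of V] edges_bounds[OF that] by simp
  then show ?thesis
    unfolding info_contribution_eq[OF rvs(1) b] info_contribution_eq[OF rvs(2) b]
      info_contribution_eq[OF rvs12 b, folded p_def] distrib_left[symmetric] sum.distrib[symmetric]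
    by (intro arg_cong2[where f = "(*)"] sum.cong) (auto simp: distrib_left)
qed

theorem theorem1:
  fixes n :: nat and b :: real and A :: "nat set" and M :: "'w measure"
    and S :: "nat \<Rightarrow> 'a set" and T :: "'y set"
    and X :: "nat \<Rightarrow> 'w \<Rightarrow> 'a" and Y :: "'w \<Rightarrow> 'y"
    and S' :: "nat \<Rightarrow> 'b set" and T' :: "'u set"
    and X' :: "nat \<Rightarrow> 'w \<Rightarrow> 'b" and Y' :: "'w \<Rightarrow> 'u"
    and S'' :: "nat \<Rightarrow> 'c set" and T'' :: "'v set"
    and X'' :: "nat \<Rightarrow> 'w \<Rightarrow> 'c" and Y'' :: "'w \<Rightarrow> 'v"
  assumes "n \<ge> 1" and "b > 1" and "A \<subseteq> {1..n}"
    and "finite_rvs n M S T X Y"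
  shows
    "info_contribution b n M S T X Y A \<ge> 0
     \<and>
     (\<Sum>B\<in>Pow {1..n}. info_contribution b n M S T X Y B) =
       input_output_information b n M S T X Y
     \<and>
     (\<forall>\<tau>. \<tau> permutes {1..n} \<longrightarrow>
       info_contribution b n M (\<lambda>i. S (\<tau> i)) T (\<lambda>i. X (\<tau> i)) Y (\<tau> -` A) =
       info_contribution b n M S T X Y A)
     \<and>
     (card A > 1 \<longrightarrow>
       info_contribution b n M S (states S {1..n}) X (tuple n X) A = 0)
     \<and>
     (finite_rvs n M S' T' X' Y' \<and> finite_rvs n M S'' T'' X'' Y'' \<and>
      (\<forall>x'\<in>states S' {1..n}. \<forall>x''\<in>states S'' {1..n}. \<forall>y'\<in>T'. \<forall>y''\<in>T''.
         measure (joint_distr n M (\<lambda>i. S' i \<times> S'' i) (T' \<times> T'')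
                    (\<lambda>i \<omega>. (X' i \<omega>, X'' i \<omega>)) (\<lambda>\<omega>. (Y' \<omega>, Y'' \<omega>)))
           {(\<lambda>i\<in>{1..n}. (x' i, x'' i), (y', y''))} =
         measure (joint_distr n M S' T' X' Y') {(x', y')} *
         measure (joint_distr n M S'' T'' X'' Y'') {(x'', y'')}) \<longrightarrow>
      info_contribution b n M (\<lambda>i. S' i \<times> S'' i) (T' \<times> T'')
        (\<lambda>i \<omega>. (X' i \<omega>, X'' i \<omega>)) (\<lambda>\<omega>. (Y' \<omega>, Y'' \<omega>)) A =
      info_contribution b n M S' T' X' Y' A +
      info_contribution b n M S'' T'' X'' Y'' A)"
proof (intro conjI allI impI)
  show "0 \<le> info_contribution b n M S T X Y A"
    by (rule info_contribution_nonneg[OF assms(4,2)])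
  show "(\<Sum>B\<in>Pow {1..n}. info_contribution b n M S T X Y B) = input_output_information b n M S T X Y"
    by (rule sum_info_contribution[OF assms(4,2)])
  show "info_contribution b n M (\<lambda>i. S (\<tau> i)) T (\<lambda>i. X (\<tau> i)) Y (\<tau> -` A) = info_contribution b n M S T X Y A"
    if "\<tau> permutes {1..n}" for \<tau>
    by (rule info_contribution_permute[OF assms(4,2) that])
  show "info_contribution b n M S (states S {1..n}) X (tuple n X) A = 0" if "card A > 1"
    by (rule info_contribution_copy[OF assms(4,2) that])
qed (elim conjE, rule info_contribution_additive[OF assms(2)], assumption, assumption, blast)

end
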